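(* Let $\mathbb{K}\in\{\mathbb{R},\mathbb{C}\}$, $\mathbf{R}_U\in\mathbb{K}^{n\times n}$ self-adjoint positive definite, $U:=\mathbb{K}^n$ with $\langle\mathbf{x},\mathbf{y}\rangle_U:=\langle\mathbf{R}_U\mathbf{x},\mathbf{y}\rangle$ and norm $\|\cdot\|_U$. Let $\mathbf{u}^1,\dots,\mathbf{u}^m\in U$, $\mathbf{U}_m:=[\mathbf{u}^1,\dots,\mathbf{u}^m]$, $U_m:=\mathrm{range}(\mathbf{U}_m)$, let $\mathbf{\Theta}\in\mathbb{K}^{k\times n}$ and $\varepsilon\in[0,1)$. Say $\mathbf{\Theta}$ is an $\varepsilon$-embedding for a subspace $V$ if $|\langle\mathbf{x},\mathbf{y}\rangle_U-\langle\mathbf{\Theta}\mathbf{x},\mathbf{\Theta}\mathbf{y}\rangle|\le\varepsilon\|\mathbf{x}\|_U\|\mathbf{y}\|_U$ for all $\mathbf{x},\mathbf{y}\in V$. Let $r$ be a positive integer, let $U_r^*$ be a minimizer of $\sum_{i=1}^m\|\mathbf{u}^i-\mathbf{P}_{W}\mathbf{u}^i\|_U^2$ over subspaces $W\subseteq U_m$ with $\dim(W)=r$, and let $U_r$ be the subspace produced by the sketched method of snapshots with parameter $r$ (defined below). Let $\Delta^{\mathrm{POD}}$ be as defined below. (i) Let $Y\subseteq U_m$ be a subspace with $\dim(Y)\ge r$ and $\Delta_Y:=\frac1m\sum_{i=1}^m\|\mathbf{u}^i-\mathbf{P}_Y\mathbf{u}^i\|_U^2$. If $\mathbf{\Theta}$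 is an $\varepsilon$-embedding for $Y$, for each of the subspaces $\mathrm{span}(\mathbf{u}^i-\mathbf{P}_Y\mathbf{u}^i)$, $i=1,\dots,m$, and for each of the subspaces $\mathrm{span}(\mathbf{u}^i-\mathbf{P}_{U_r^*}\mathbf{u}^i)$, $i=1,\dots,m$, then $$\frac1m\sum_{i=1}^m\|\mathbf{u}^i-\mathbf{P}_{U_r}\mathbf{u}^i\|_U^2\le\frac{2}{1-\varepsilon}\Delta^{\mathrm{POD}}(U_r)+\Big(\frac{2(1+\varepsilon)}{1-\varepsilon}+1\Big)\Delta_Y\le\frac{2(1+\varepsilon)}{1-\varepsilon}\,\frac1m\sum_{i=1}^m\|\mathbf{u}^i-\mathbf{P}_{U_r^*}\mathbf{u}^i\|_U^2+\Big(\frac{2(1+\varepsilon)}{1-\varepsilon}+1\Big)\Delta_Y.$$ (ii) If $\mathbf{\Theta}$ is an $\varepsilon$-embedding for $U_m$ (and $r\le\dim U_m$), then $$\frac1m\sum_{i=1}^m\|\mathbf{u}^i-\mathbf{P}_{U_r}\mathbf{u}^i\|_U^2\le\frac{1}{1-\varepsilon}\Delta^{\mathrm{POD}}(U_r)\le\frac{1+\varepsilon}{1-\varepsilon}\,\frac1m\sum_{i=1}^m\|\mathbf{u}^i-\mathbf{P}_{U_r^*}\mathbf{u}^i\|_U^2.$$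
   Context: $\langle\mathbf{x},\mathbf{y}\rangle=\mathbf{x}^{\mathrm{H}}\mathbf{y}$, $\|\cdot\|$ Euclidean norm; $\mathbf{P}_V$ is the $\langle\cdot,\cdot\rangle_U$-orthogonal projection onto a subspace $V$. Sketched method of snapshots: let $\mathbf{G}:=(\mathbf{\Theta}\mathbf{U}_m)^{\mathrm{H}}\mathbf{\Theta}\mathbf{U}_m$, $l:=\mathrm{rank}(\mathbf{\Theta}\mathbf{U}_m)$ (with $r\le l$, so that $U_r$ is defined), and let $(\lambda_i,\mathbf{t}_i)_{i=1}^l$ be eigenpairs of $\mathbf{G}$ for its nonzero eigenvalues, with orthonormal eigenvectors and $\lambda_1\ge\dots\ge\lambda_l$; then $U_r:=\mathrm{range}(\mathbf{U}_m[\mathbf{t}_1,\dots,\mathbf{t}_r])$. For $V\subseteq U_m$ and $\mathbf{x}\in U_m$ let $\mathbf{P}_V^{\mathbf{\Theta}}\mathbf{x}\in\arg\min_{\mathbf{w}\in V}\|\mathbf{\Theta}(\mathbf{x}-\mathbf{w})\|$, and $\Delta^{\mathrm{POD}}(V):=\frac1m\sum_{i=1}^m\|\mathbf{\Theta}(\mathbf{u}^i-\mathbf{P}_V^{\mathbf{\Theta}}\mathbf{u}^i)\|^2$. *)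

theory Defs
  imports "Jordan_Normal_Form.Schur_Decomposition" "Jordan_Normal_Form.DL_Rank"
begin

text \<open>Generic setting: the scalar field is a type of sort conjugatable_field and
real_normed_field; the statement is instantiated for real and complex.
Vectors in K^n are JNF vectors in carrier_vec n, matrices are JNF matrices.\<close>

definition ip :: "'a::conjugatable_field vec \<Rightarrow> 'a vec \<Rightarrow> 'a" where
  "ip x y = conjugate x \<bullet> y"

definition enorm :: "'a::{conjugatable_field,real_normed_field} vec \<Rightarrow> real" where
  "enorm y = sqrt (norm (ip y y))"

definition ipU :: "'a::conjugatable_field mat \<Rightarrow> 'a vec \<Rightarrow> 'a vec \<Rightarrow> 'a" where
  "ipU R x y = ip (R *\<^sub>v x) y"

definition normU :: "'a::{conjugatable_field,real_normed_field} mat \<Rightarrow> 'a vec \<Rightarrow> real" where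
  "normU R x = sqrt (norm (ipU R x x))"

definition hermitian_pd :: "nat \<Rightarrow> 'a::{conjugatable_field,real_normed_field} mat \<Rightarrow> bool" where
  "hermitian_pd n R \<longleftrightarrow> R \<in> carrier_mat n n \<and> mat_adjoint R = R \<and>
     (\<forall>x\<in>carrier_vec n. x \<noteq> 0\<^sub>v n \<longrightarrow> (\<exists>t::real. t > 0 \<and> ip (R *\<^sub>v x) x = of_real t))"

definition is_subspace :: "nat \<Rightarrow> 'a::field vec set \<Rightarrow> bool" where
  "is_subspace n W \<longleftrightarrow> VectorSpace.subspace class_ring W (module_vec TYPE('a) n)"

definition sdim :: "nat \<Rightarrow> 'a::field vec set \<Rightarrow> nat" where
  "sdim n W = vectorspace.dim class_ring ((module_vec TYPE('a) n)\<lparr>carrier := W\<rparr>)"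

definition mrange :: "'a::field mat \<Rightarrow> 'a vec set" where
  "mrange A = {A *\<^sub>v x | x. x \<in> carrier_vec (dim_col A)}"

definition span1 :: "'a::field vec \<Rightarrow> 'a vec set" where
  "span1 w = {c \<cdot>\<^sub>v w | c. True}"

definition snap_mat :: "nat \<Rightarrow> nat \<Rightarrow> (nat \<Rightarrow> 'a::field vec) \<Rightarrow> 'a mat" where
  "snap_mat n m us = mat_of_cols n (map us [0..<m])"

definition projU :: "'a::conjugatable_field mat \<Rightarrow> 'a vec set \<Rightarrow> 'a vec \<Rightarrow> 'a vec" where
  "projU R V x = (THE w. w \<in> V \<and> (\<forall>v\<in>V. ipU R v (x - w) = 0))"

definition projTheta :: "'a::{conjugatable_field,real_normed_field} mat \<Rightarrow> 'a vec set \<Rightarrow> 'a vec \<Rightarrow> 'a vec" where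
  "projTheta Th V x = (SOME w. w \<in> V \<and>
      (\<forall>w'\<in>V. enorm (Th *\<^sub>v (x - w)) \<le> enorm (Th *\<^sub>v (x - w'))))"

definition pod_err :: "'a::{conjugatable_field,real_normed_field} mat \<Rightarrow> nat \<Rightarrow> (nat \<Rightarrow> 'a vec) \<Rightarrow> 'a vec set \<Rightarrow> real" where
  "pod_err R m us V = (1 / real m) * (\<Sum>i<m. (normU R (us i - projU R V (us i)))\<^sup>2)"

definition delta_pod :: "'a::{conjugatable_field,real_normed_field} mat \<Rightarrow> nat \<Rightarrow> (nat \<Rightarrow> 'a vec) \<Rightarrow> 'a vec set \<Rightarrow> real" where
  "delta_pod Th m us V = (1 / real m) * (\<Sum>i<m. (enorm (Th *\<^sub>v (us i - projTheta Th V (us i))))\<^sup>2)"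

definition eps_embedding :: "'a::{conjugatable_field,real_normed_field} mat \<Rightarrow> 'a mat \<Rightarrow> real \<Rightarrow> 'a vec set \<Rightarrow> bool" where
  "eps_embedding R Th \<epsilon> V \<longleftrightarrow> (\<forall>x\<in>V. \<forall>y\<in>V.
      norm (ipU R x y - ip (Th *\<^sub>v x) (Th *\<^sub>v y)) \<le> \<epsilon> * normU R x * normU R y)"

definition POD_minimizer :: "nat \<Rightarrow> 'a::{conjugatable_field,real_normed_field} mat \<Rightarrow> nat \<Rightarrow> (nat \<Rightarrow> 'a vec) \<Rightarrow> nat \<Rightarrow> 'a vec set \<Rightarrow> bool" where
  "POD_minimizer n R m us r W \<longleftrightarrow>
     is_subspace n W \<and> W \<subseteq> mrange (snap_mat n m us) \<and> sdim n W = r \<and>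
     (\<forall>W'. is_subspace n W' \<and> W' \<subseteq> mrange (snap_mat n m us) \<and> sdim n W' = r \<longrightarrow>
        (\<Sum>i<m. (normU R (us i - projU R W (us i)))\<^sup>2) \<le> (\<Sum>i<m. (normU R (us i - projU R W' (us i)))\<^sup>2))"

definition sk_gram :: "'a::conjugatable_field mat \<Rightarrow> 'a mat \<Rightarrow> 'a mat" where
  "sk_gram Th Um = mat_adjoint (Th * Um) * (Th * Um)"

text \<open>(lam i, t i), i < l, are the eigenpairs of G for its nonzero eigenvalues, with
  l = rank(Theta U_m), orthonormal eigenvectors and non-increasing eigenvalues
  (indices shifted to start at 0).\<close>
definition sk_eigenpairs :: "nat \<Rightarrow> nat \<Rightarrow> nat \<Rightarrow> 'a::{conjugatable_field,real_normed_field} mat \<Rightarrow> (nat \<Rightarrow> 'a vec) \<Rightarrow> nat \<Rightarrow> (nat \<Rightarrow> real) \<Rightarrow> (nat \<Rightarrow> 'a vec) \<Rightarrow> bool" where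
  "sk_eigenpairs n k m Th us l lam t \<longleftrightarrow>
     l = vec_space.rank k (Th * snap_mat n m us) \<and>
     (\<forall>i<l. t i \<in> carrier_vec m \<and> lam i \<noteq> 0 \<and>
        sk_gram Th (snap_mat n m us) *\<^sub>v t i = of_real (lam i) \<cdot>\<^sub>v t i) \<and>
     (\<forall>i<l. \<forall>j<l. ip (t i) (t j) = (if i = j then 1 else 0)) \<and>
     (\<forall>i j. i \<le> j \<longrightarrow> j < l \<longrightarrow> lam j \<le> lam i)"

definition sk_Ur :: "nat \<Rightarrow> nat \<Rightarrow> (nat \<Rightarrow> 'a::field vec) \<Rightarrow> (nat \<Rightarrow> 'a vec) \<Rightarrow> nat \<Rightarrow> 'a vec set" where
  "sk_Ur n m us t r = mrange (snap_mat n m us * mat_of_cols m (map t [0..<r]))"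

end

theory Submission
  imports Defs
begin

text \<open>Write \<open>T\<close> for the matrix with columns \<open>t 0, \<dots>, t (r - 1)\<close> and \<open>D = U\<^sub>m (I - T T\<^sup>H)\<close>. The columns
  of \<open>D\<close> are the snapshots minus elements of \<open>U\<^sub>r\<close>, and \<open>\<Theta> D\<close> is orthogonal to \<open>\<Theta> U\<^sub>r\<close> because the
  columns of \<open>T\<close> are eigenvectors of the sketched Gram matrix. Hence \<open>\<Delta>\<^sup>P\<^sup>O\<^sup>D (U\<^sub>r)\<close> is the mean squared
  norm of the columns of \<open>\<Theta> D\<close>, and Eckart--Young bounds it by the sketched error of any other
  \<open>r\<close>-dimensional space, in particular \<open>U\<^sub>r\<^sup>*\<close>.

  If \<open>\<Theta>\<close> embeds \<open>U\<^sub>m\<close>, the columns of \<open>D\<close> lie in \<open>U\<^sub>m\<close> and the lower embedding bound applies directly.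
  If it only embeds \<open>Y\<close>, split \<open>D = P\<^sub>Y D + F\<close> with \<open>F = (I - P\<^sub>Y) U\<^sub>m (I - T T\<^sup>H)\<close>. The first summand is
  controlled by the embedding of \<open>Y\<close> and \<open>\<Theta> P\<^sub>Y D = \<Theta> D - \<Theta> F\<close>. Right multiplication by the orthogonal
  projection \<open>I - T T\<^sup>H\<close> does not increase Frobenius norms, which bounds both \<open>F\<close> and \<open>\<Theta> F\<close> by
  \<open>(I - P\<^sub>Y) U\<^sub>m\<close>, whose columns are embedded one by one.\<close>

subsection \<open>Scalars and linear combinations\<close>

text \<open>The sort used in the definitions does not relate \<open>conjugate\<close> to \<open>norm\<close>; this class adds the
  law shared by the real and complex numbers. It uses \<open>scaleR\<close> because \<open>of_real\<close> is not
  available inside a class specification.\<close>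
class rc_field = conjugatable_field + real_normed_field +
  assumes conjugate_mult_self_scaleR: "conjugate a * a = ((norm a)\<^sup>2) *\<^sub>R 1"

lemma conjugate_mult_self: "conjugate a * a = of_real ((norm (a :: 'a::rc_field))\<^sup>2)"
  by (simp add: conjugate_mult_self_scaleR of_real_def)

instance real :: rc_field
  by standard (simp add: power2_eq_square)

instance complex :: rc_field
proof
  show "conjugate a * a = (norm a)\<^sup>2 *\<^sub>R 1" for a :: complex
    using complex_norm_square[of a] by (simp add: scaleR_conv_of_real mult.commute)
qed

text \<open>For real \<open>a\<close> the class law reads \<open>conjugate a * a = a * a\<close>,
  and a nonzero factor cancels.\<close>

lemma conjugate_of_real [simp]: "conjugate (of_real t :: 'a::rc_field) = of_real t"
proof (cases "t = 0")
  case False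
  have "conjugate (of_real t :: 'a) * of_real t = of_real t * of_real t"
    by (simp add: conjugate_mult_self power2_eq_square)
  with False show ?thesis by simp
qed simp

text \<open>Applying the class law to \<open>a\<close> and to \<open>conjugate a\<close> yields the
  same product up to commutativity.\<close>

lemma norm_conjugate [simp]: "norm (conjugate a) = norm (a :: 'a::rc_field)"
proof -
  have "(of_real ((norm (conjugate a))\<^sup>2) :: 'a) = of_real ((norm a)\<^sup>2)"
    using conjugate_mult_self[of a] conjugate_mult_self[of "conjugate a"]
    by (simp add: mult.commute del: of_real_power)
  then have "(norm (conjugate a))\<^sup>2 = (norm a)\<^sup>2"
    by (simp only: of_real_eq_iff)
  then show ?thesis by simp
qed

lemma conjugate_diff: "conjugate (a - b :: 'a::conjugatable_ring) = conjugate a - conjugate b"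
  using conjugate_dist_add[of a "- b"] by (simp add: conjugate_neg)

text \<open>Families are indexed by the numbers below \<open>e\<close>, so repeated or dependent
  vectors need no side condition and the coefficients form a coordinate vector.\<close>

definition lc :: "nat \<Rightarrow> nat \<Rightarrow> (nat \<Rightarrow> 'a::field) \<Rightarrow> (nat \<Rightarrow> 'a vec) \<Rightarrow> 'a vec" where
  "lc n e c s = vec n (\<lambda>a. \<Sum>i<e. c i * s i $ a)"

definition vspan :: "nat \<Rightarrow> nat \<Rightarrow> (nat \<Rightarrow> 'a::field vec) \<Rightarrow> 'a vec set" where
  "vspan n e s = range (\<lambda>c. lc n e c s)"

lemma lc_carrier [simp]: "lc n e c s \<in> carrier_vec n"
  and dim_lc [simp]: "dim_vec (lc n e c s) = n"
  by (simp_all add: lc_def)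

lemma lc_in_vspan [simp]: "lc n e c s \<in> vspan n e s"
  by (simp add: vspan_def)

lemma vspanE:
  assumes "x \<in> vspan n e s"
  obtains c where "x = lc n e c s"
  using assms by (auto simp: vspan_def)

lemma vspan_carrier: "vspan n e s \<subseteq> carrier_vec n"
  by (auto simp: vspan_def)

lemma lc_cong:
  "(\<And>i. i < e \<Longrightarrow> c i = c' i) \<Longrightarrow> (\<And>i. i < e \<Longrightarrow> s i = s' i) \<Longrightarrow> lc n e c s = lc n e c' s'"
  by (simp add: lc_def)

lemma lc_0 [simp]: "lc n 0 c s = 0\<^sub>v n"
  by (auto simp: lc_def)

lemma lc_Suc: "s e \<in> carrier_vec n \<Longrightarrow> lc n (Suc e) c s = lc n e c s + c e \<cdot>\<^sub>v s e"
  by (auto simp: lc_def)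

lemma lc_add: "lc n e c s + lc n e d s = lc n e (\<lambda>i. c i + d i) s"
  by (auto simp: lc_def sum.distrib algebra_simps)

lemma lc_diff: "lc n e c s - lc n e d s = lc n e (\<lambda>i. c i - d i) s"
  by (auto simp: lc_def sum_subtractf algebra_simps)

lemma lc_smult: "a \<cdot>\<^sub>v lc n e c s = lc n e (\<lambda>i. a * c i) s"
  by (auto simp: lc_def sum_distrib_left algebra_simps)

lemma lc_lc: "lc n d c (\<lambda>i. lc n e (a i) s) = lc n e (\<lambda>j. \<Sum>i<d. c i * a i j) s"
proof -
  have "(\<Sum>i<d. c i * (\<Sum>j<e. a i j * s j $ b)) = (\<Sum>j<e. (\<Sum>i<d. c i * a i j) * s j $ b)" for b
  proof -
    have "(\<Sum>i<d. c i * (\<Sum>j<e. a i j * s j $ b)) = (\<Sum>i<d. \<Sum>j<e. c i * a i j * s j $ b)"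
      by (simp add: sum_distrib_left mult.assoc)
    also have "\<dots> = (\<Sum>j<e. \<Sum>i<d. c i * a i j * s j $ b)" by (rule sum.swap)
    finally show ?thesis by (simp add: sum_distrib_right)
  qed
  then show ?thesis by (auto simp: lc_def)
qed

lemma lc_family_add:
  assumes "\<And>i. i < e \<Longrightarrow> p i \<in> carrier_vec n" "\<And>i. i < e \<Longrightarrow> q i \<in> carrier_vec n"
  shows "lc n e c (\<lambda>i. p i + q i) = lc n e c p + lc n e c q"
proof (rule eq_vecI)
  fix a assume "a < dim_vec (lc n e c p + lc n e c q)"
  then have a: "a < n" by simp
  have "(\<Sum>i<e. c i * (p i + q i) $ a) = (\<Sum>i<e. c i * p i $ a + c i * q i $ a)"
    using carrier_vecD[OF assms(1)] carrier_vecD[OF assms(2)] a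
    by (intro sum.cong) (auto simp: distrib_left)
  then show "lc n e c (\<lambda>i. p i + q i) $ a = (lc n e c p + lc n e c q) $ a"
    using a by (simp add: lc_def sum.distrib)
qed simp

lemma lc_delta:
  assumes "j < e" "s j \<in> carrier_vec n"
  shows "lc n e (\<lambda>i. if i = j then 1 else 0) s = s j"
proof -
  have "(\<Sum>i<e. (if i = j then 1 else 0) * s i $ a) = s j $ a" for a
    using assms(1) by (simp add: if_distrib[of "\<lambda>x. x * _"] cong: if_cong)
  then show ?thesis using assms by (auto simp: lc_def)
qed

lemma mat_mult_lc:
  assumes "M \<in> carrier_mat k n" "\<And>i. i < e \<Longrightarrow> s i \<in> carrier_vec n"
  shows "M *\<^sub>v lc n e c s = lc k e c (\<lambda>i. M *\<^sub>v s i)"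
proof (rule eq_vecI)
  fix b assume b: "b < dim_vec (lc k e c (\<lambda>i. M *\<^sub>v s i))"
  have d: "dim_vec (s i) = n" if "i < e" for i using assms(2)[OF that] by simp
  have "(M *\<^sub>v lc n e c s) $ b = (\<Sum>a = 0..<n. \<Sum>i<e. c i * (M $$ (b, a) * s i $ a))"
    using assms(1) b by (auto simp: lc_def scalar_prod_def sum_distrib_left mult.left_commute)
  also have "\<dots> = (\<Sum>i<e. c i * (\<Sum>a = 0..<n. M $$ (b, a) * s i $ a))"
    by (subst sum.swap) (simp add: sum_distrib_left)
  also have "\<dots> = lc k e c (\<lambda>i. M *\<^sub>v s i) $ b"
    using assms(1) b d by (auto simp: lc_def scalar_prod_def intro!: sum.cong)
  finally show "(M *\<^sub>v lc n e c s) $ b = lc k e c (\<lambda>i. M *\<^sub>v s i) $ b" .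
qed (use assms in auto)

lemma mat_of_cols_mult_vec:
  assumes "x \<in> carrier_vec d"
  shows "mat_of_cols n (map f [0..<d]) *\<^sub>v x = lc n d (\<lambda>i. x $ i) f"
  using assms
  by (intro eq_vecI) (auto simp: lc_def scalar_prod_def mat_of_cols_def mult.commute atLeast0LessThan)

text \<open>The bridge from matrices to families: the range of the snapshots,
  \<open>U\<^sub>r\<close> and the range of the sketched snapshots are all treated as a
  \<open>vspan\<close>.\<close>

lemma mrange_mat_of_cols: "mrange (mat_of_cols n (map f [0..<d])) = vspan n d f"
proof
  show "mrange (mat_of_cols n (map f [0..<d])) \<subseteq> vspan n d f"
    by (auto simp: mrange_def mat_of_cols_mult_vec)
  show "vspan n d f \<subseteq> mrange (mat_of_cols n (map f [0..<d]))"
  proof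
    fix x assume "x \<in> vspan n d f"
    then obtain c where "x = lc n d c f" by (rule vspanE)
    then have "x = mat_of_cols n (map f [0..<d]) *\<^sub>v vec d c"
      by (simp add: mat_of_cols_mult_vec) (rule lc_cong, auto)
    then show "x \<in> mrange (mat_of_cols n (map f [0..<d]))"
      by (auto simp: mrange_def)
  qed
qed

lemma vspan_mem: "j < e \<Longrightarrow> s j \<in> carrier_vec n \<Longrightarrow> s j \<in> vspan n e s"
  by (metis lc_delta lc_in_vspan)

lemma vspan_add: "x \<in> vspan n e s \<Longrightarrow> y \<in> vspan n e s \<Longrightarrow> x + y \<in> vspan n e s"
  by (auto elim!: vspanE simp: lc_add)

lemma vspan_diff: "x \<in> vspan n e s \<Longrightarrow> y \<in> vspan n e s \<Longrightarrow> x - y \<in> vspan n e s"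
  by (auto elim!: vspanE simp: lc_diff)

lemma vspan_smult: "x \<in> vspan n e s \<Longrightarrow> a \<cdot>\<^sub>v x \<in> vspan n e s"
  by (auto elim!: vspanE simp: lc_smult)

lemma vspan_lc:
  assumes "\<And>i. i < d \<Longrightarrow> w i \<in> vspan n e s"
  shows "lc n d c w \<in> vspan n e s"
proof -
  have "\<forall>i. \<exists>a. i < d \<longrightarrow> w i = lc n e a s"
    using assms by (meson vspanE)
  then obtain a where "\<And>i. i < d \<Longrightarrow> w i = lc n e (a i) s" by metis
  then have "lc n d c w = lc n d c (\<lambda>i. lc n e (a i) s)" by (intro lc_cong) auto
  then show ?thesis by (simp add: lc_lc)
qed

lemma vspan_mono:
  "(\<And>i. i < d \<Longrightarrow> w i \<in> vspan n e s) \<Longrightarrow> vspan n d w \<subseteq> vspan n e s"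
  by (auto elim!: vspanE intro!: vspan_lc)

text \<open>Independent subsets of \<open>W\<close> have bounded size, so a maximal one exists and
  generates \<open>W\<close>. The dimension is the least size of a generating set; enumerating a set
  that attains it gives the family.\<close>

lemma is_subspace_vspan_dim:
  fixes W :: "'a::field vec set"
  assumes "is_subspace n W"
  obtains D w where "D = sdim n W" "\<forall>i<D. w i \<in> carrier_vec n" "W = vspan n D w"
proof -
  interpret V: vec_space "TYPE('a)" n .
  have sub: "VectorSpace.subspace class_ring W V.V" using assms by (simp add: is_subspace_def)
  then have subm: "submodule class_ring W V.V" by (simp add: VectorSpace.subspace_def)
  then have Wc: "W \<subseteq> carrier_vec n" using submodule.subset by fastforce
  interpret w: vectorspace class_ring "V.vs W" by (rule V.subspace_is_vs[OF sub])
  have small: "finite S \<and> card S \<le> V.dim" if "S \<subseteq> carrier (V.vs W) \<and> w.lin_indpt S" for S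
    using that V.span_li_not_depend(2)[OF _ subm, of S] Wc by (auto intro!: V.li_le_dim)
  have "w.lin_indpt {}" by (auto simp: w.lin_dep_def)
  then obtain S where S: "finite S" "maximal S (\<lambda>S. S \<subseteq> carrier (V.vs W) \<and> w.lin_indpt S)"
    using maximal_exists[of "\<lambda>S. S \<subseteq> carrier (V.vs W) \<and> w.lin_indpt S", OF small] by fastforce
  \<comment> \<open>Some finite generating set must exist before the least cardinality in
    \<open>w.dim_def\<close> is known to be attained.\<close>
  have "\<exists>d A. finite A \<and> card A = d \<and> A \<subseteq> carrier (V.vs W) \<and> w.gen_set A"
    using S w.max_li_is_gen[OF S(2)] by (auto simp: maximal_def)
  then have "\<exists>A. finite A \<and> card A = w.dim \<and> A \<subseteq> carrier (V.vs W) \<and> w.gen_set A"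
    unfolding w.dim_def by (rule LeastI_ex)
  then obtain A where A: "finite A" "card A = w.dim" "A \<subseteq> W" "w.span A = W"
    by auto
  have sd: "sdim n W = w.dim" by (simp add: sdim_def)
  obtain f where f: "bij_betw f {..<w.dim} A"
    using ex_bij_betw_nat_finite[OF A(1)] A(2) by (auto simp: atLeast0LessThan)
  have span: "V.span A = W" using V.span_li_not_depend(1)[OF A(3) subm] A(4) by simp
  have Ac: "A \<subseteq> carrier_vec n" using A(3) Wc by auto
  have lin: "V.lincomb a A = lc n w.dim (\<lambda>i. a (f i)) f" for a
    using Ac A(1) V.lincomb_index[OF _ Ac, of _ a]
    by (intro eq_vecI) (auto simp: lc_def sum.reindex_bij_betw[OF f, of "\<lambda>x. a x * x $ _"]
        V.lincomb_dim)
  show ?thesis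
  proof
    show "sdim n W = sdim n W" ..
    show "\<forall>i<sdim n W. f i \<in> carrier_vec n"
      using f Ac by (auto simp: sd bij_betw_def)
    show "W = vspan n (sdim n W) f"
    proof
      show "W \<subseteq> vspan n (sdim n W) f"
      proof
        fix x assume "x \<in> W"
        then obtain a where "V.lincomb a A = x"
          using V.finite_in_span[OF A(1), of x] Ac span by auto
        then show "x \<in> vspan n (sdim n W) f" using lin[of a] by (auto simp: sd)
      qed
      show "vspan n (sdim n W) f \<subseteq> W"
      proof
        fix x assume "x \<in> vspan n (sdim n W) f"
        then obtain c where x: "x = lc n w.dim c f" by (auto simp: sd elim: vspanE)
        \<comment> \<open>Coefficients attached to positions become coefficients attached to
          vectors, which is possible because \<open>f\<close> is injective.\<close>
        define a where "a = c \<circ> inv_into {..<w.dim} f"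
        have "x = V.lincomb a A" unfolding lin x
          using f by (intro lc_cong) (auto simp: a_def bij_betw_def inv_into_f_f)
        also have "\<dots> \<in> V.span A" using A(1) by (auto simp: V.span_def)
        finally show "x \<in> W" by (simp add: span)
      qed
    qed
  qed
qed

subsection \<open>Inner products on coordinate spaces\<close>

text \<open>One setting for both \<open>ipU R\<close> and \<open>ip\<close>, linear in the second
  argument. The scalar class has no order, so \<open>self_of_real\<close> expresses that
  \<open>B x x\<close> is real and nonnegative.\<close>

locale vec_inner =
  fixes n :: nat and B :: "'a::rc_field vec \<Rightarrow> 'a vec \<Rightarrow> 'a"
  assumes add_right: "\<lbrakk>x \<in> carrier_vec n; y \<in> carrier_vec n; z \<in> carrier_vec n\<rbrakk>
      \<Longrightarrow> B x (y + z) = B x y + B x z"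
    and smult_right: "\<lbrakk>x \<in> carrier_vec n; y \<in> carrier_vec n\<rbrakk> \<Longrightarrow> B x (a \<cdot>\<^sub>v y) = a * B x y"
    and conj_sym: "\<lbrakk>x \<in> carrier_vec n; y \<in> carrier_vec n\<rbrakk> \<Longrightarrow> conjugate (B x y) = B y x"
    and self_of_real: "x \<in> carrier_vec n \<Longrightarrow> B x x = of_real (norm (B x x))"
    and definite: "\<lbrakk>x \<in> carrier_vec n; B x x = 0\<rbrakk> \<Longrightarrow> x = 0\<^sub>v n"
begin

text \<open>The squared norm. Its sum over the columns of a matrix is the squared Frobenius
  norm.\<close>

definition N :: "'a vec \<Rightarrow> real" where "N x = norm (B x x)"

lemma N_nonneg [simp]: "N x \<ge> 0"
  by (simp add: N_def)

lemma B_self: "x \<in> carrier_vec n \<Longrightarrow> B x x = of_real (N x)"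
  using self_of_real by (simp add: N_def)

lemma zero_right [simp]: "x \<in> carrier_vec n \<Longrightarrow> B x (0\<^sub>v n) = 0"
proof -
  assume x: "x \<in> carrier_vec n"
  have "0 \<cdot>\<^sub>v 0\<^sub>v n = (0\<^sub>v n :: 'a vec)" by auto
  then show ?thesis using smult_right[OF x zero_carrier_vec, of 0] by simp
qed

lemma add_left:
  assumes "x \<in> carrier_vec n" "y \<in> carrier_vec n" "z \<in> carrier_vec n"
  shows "B (y + z) x = B y x + B z x"
  using add_right[OF assms] assms
  by (simp add: conj_sym[symmetric, of x] conjugate_dist_add)

lemma smult_left:
  assumes "x \<in> carrier_vec n" "y \<in> carrier_vec n"
  shows "B (a \<cdot>\<^sub>v y) x = conjugate a * B y x"
  using smult_right[OF assms] assms
  by (simp add: conj_sym[symmetric, of x] conjugate_dist_mul)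

lemma minus_right:
  assumes "x \<in> carrier_vec n" "y \<in> carrier_vec n" "z \<in> carrier_vec n"
  shows "B x (y - z) = B x y - B x z"
proof -
  have "y - z = y + (-1) \<cdot>\<^sub>v z" using assms by auto
  then show ?thesis using assms by (simp add: add_right smult_right)
qed

lemma minus_left:
  assumes "x \<in> carrier_vec n" "y \<in> carrier_vec n" "z \<in> carrier_vec n"
  shows "B (y - z) x = B y x - B z x"
  using minus_right[OF assms] assms
  by (simp add: conj_sym[symmetric, of x] conjugate_diff)

lemma norm_sym: "\<lbrakk>x \<in> carrier_vec n; y \<in> carrier_vec n\<rbrakk> \<Longrightarrow> norm (B x y) = norm (B y x)"
  using norm_conjugate[of "B x y"] by (simp add: conj_sym)

lemma lc_right:
  "x \<in> carrier_vec n \<Longrightarrow> (\<And>i. i < e \<Longrightarrow> s i \<in> carrier_vec n)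
    \<Longrightarrow> B x (lc n e c s) = (\<Sum>i<e. c i * B x (s i))"
  by (induction e) (simp_all add: lc_Suc add_right smult_right)

lemma lc_left:
  "x \<in> carrier_vec n \<Longrightarrow> (\<And>i. i < e \<Longrightarrow> s i \<in> carrier_vec n)
    \<Longrightarrow> B (lc n e c s) x = (\<Sum>i<e. conjugate (c i) * B (s i) x)"
proof (induction e)
  case 0
  then show ?case using conj_sym[of x "0\<^sub>v n"] by simp
qed (simp add: lc_Suc add_left smult_left)

lemma N_eq_0: "x \<in> carrier_vec n \<Longrightarrow> N x = 0 \<Longrightarrow> x = 0\<^sub>v n"
  by (simp add: N_def definite)

lemma N_add_orthogonal:
  assumes "x \<in> carrier_vec n" "y \<in> carrier_vec n" "B x y = 0"
  shows "N (x + y) = N x + N y"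
proof -
  have "B y x = 0" using assms conj_sym[of x y] by simp
  then have "B (x + y) (x + y) = B x x + B y y"
    using assms by (simp add: add_left add_right)
  then have "of_real (N (x + y)) = (of_real (N x + N y) :: 'a)"
    using assms by (simp add: B_self)
  then show ?thesis by (simp only: of_real_eq_iff)
qed

text \<open>The parallelogram identity with \<open>N (x + y)\<close> dropped. The factor 2 in part
  (i) originates here.\<close>

lemma parallelogram_le:
  assumes "x \<in> carrier_vec n" "y \<in> carrier_vec n"
  shows "N (x - y) \<le> 2 * N x + 2 * N y"
proof -
  have "B (x + y) (x + y) + B (x - y) (x - y) = 2 * B x x + 2 * B y y"
    using assms by (simp add: add_left add_right minus_left minus_right)
  then have "of_real (N (x + y) + N (x - y)) = (of_real (2 * N x + 2 * N y) :: 'a)"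
    using assms by (simp add: B_self)
  then have "N (x + y) + N (x - y) = 2 * N x + 2 * N y" by (simp only: of_real_eq_iff)
  then show ?thesis using N_nonneg[of "x + y"] by linarith
qed

section \<open>Orthonormal families: projection, Bessel, Gram-Schmidt and counting\<close>

definition orthonormal :: "nat \<Rightarrow> (nat \<Rightarrow> 'a vec) \<Rightarrow> bool" where
  "orthonormal e s \<longleftrightarrow> (\<forall>i<e. s i \<in> carrier_vec n) \<and>
     (\<forall>i<e. \<forall>j<e. B (s i) (s j) = (if i = j then 1 else 0))"

lemma orthonormal_carrier: "orthonormal e s \<Longrightarrow> i < e \<Longrightarrow> s i \<in> carrier_vec n"
  by (simp add: orthonormal_def)

lemma orthonormal_coeff:
  assumes "orthonormal e s" "j < e"
  shows "B (s j) (lc n e c s) = c j"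
proof -
  have "B (s j) (lc n e c s) = (\<Sum>i<e. c i * (if j = i then 1 else 0))"
    using assms by (subst lc_right) (auto simp: orthonormal_def intro!: sum.cong)
  also have "\<dots> = c j" using assms(2) by (simp add: if_distrib[of "\<lambda>x. _ * x"] cong: if_cong)
  finally show ?thesis .
qed

lemma N_lc:
  assumes "orthonormal e s"
  shows "N (lc n e c s) = (\<Sum>i<e. (norm (c i))\<^sup>2)"
proof -
  have "of_real (N (lc n e c s)) = B (lc n e c s) (lc n e c s)" by (simp add: B_self)
  also have "\<dots> = (\<Sum>i<e. conjugate (c i) * B (s i) (lc n e c s))"
    using assms by (intro lc_left) (auto simp: orthonormal_def)
  also have "\<dots> = (\<Sum>i<e. of_real ((norm (c i))\<^sup>2))"
    using assms by (intro sum.cong) (auto simp: orthonormal_coeff conjugate_mult_self)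
  also have "\<dots> = of_real (\<Sum>i<e. (norm (c i))\<^sup>2)" by simp
  finally show ?thesis by (simp only: of_real_eq_iff)
qed

text \<open>An explicit Fourier sum; \<open>projU_vspan\<close> identifies it with
  \<open>projU\<close> when \<open>s\<close> is an orthonormal basis of the subspace.\<close>

definition proj :: "nat \<Rightarrow> (nat \<Rightarrow> 'a vec) \<Rightarrow> 'a vec \<Rightarrow> 'a vec" where
  "proj e s x = lc n e (\<lambda>i. B (s i) x) s"

lemma proj_carrier [simp]: "proj e s x \<in> carrier_vec n"
  by (simp add: proj_def)

lemma residual_orthogonal_lc:
  assumes "orthonormal e s" "x \<in> carrier_vec n"
  shows "B (lc n e c s) (x - proj e s x) = 0"
proof -
  have "B (s i) (x - proj e s x) = 0" if "i < e" for i
    using assms that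
    by (simp add: minus_right orthonormal_carrier proj_def orthonormal_coeff)
  then show ?thesis using assms by (subst lc_left) (auto simp: orthonormal_carrier)
qed

text \<open>Pythagoras: the difference is a combination of \<open>s\<close> plus the residual of
  \<open>x\<close>, and the two are orthogonal. Zero coefficients give the Pythagorean identity for
  \<open>x\<close> and Bessel's inequality.\<close>

lemma N_minus_lc:
  assumes "orthonormal e s" "x \<in> carrier_vec n"
  shows "N (x - lc n e c s) = N (x - proj e s x) + (\<Sum>i<e. (norm (B (s i) x - c i))\<^sup>2)"
proof -
  let ?d = "lc n e (\<lambda>i. B (s i) x - c i) s"
  have "x - lc n e c s = ?d + (x - proj e s x)"
    using assms(2) unfolding lc_diff[symmetric] proj_def by (intro eq_vecI) auto
  then have "N (x - lc n e c s) = N (?d + (x - proj e s x))" by (rule arg_cong)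
  also have "\<dots> = N ?d + N (x - proj e s x)"
    using assms(2) by (intro N_add_orthogonal residual_orthogonal_lc[OF assms]) simp_all
  also have "N ?d = (\<Sum>i<e. (norm (B (s i) x - c i))\<^sup>2)" by (rule N_lc[OF assms(1)])
  finally show ?thesis by (simp only: add.commute)
qed

lemma N_proj_pythagoras:
  assumes "orthonormal e s" "x \<in> carrier_vec n"
  shows "N x = N (x - proj e s x) + (\<Sum>i<e. (norm (B (s i) x))\<^sup>2)"
proof -
  have "x - lc n e (\<lambda>i. 0) s = x" using assms(2) by (intro eq_vecI) (auto simp: lc_def)
  then show ?thesis using N_minus_lc[OF assms, of "\<lambda>i. 0"] by (simp only: diff_zero)
qed

lemma bessel:
  assumes "orthonormal e s" "x \<in> carrier_vec n"
  shows "(\<Sum>i<e. (norm (B (s i) x))\<^sup>2) \<le> N x"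
  using N_proj_pythagoras[OF assms] N_nonneg[of "x - proj e s x"] by linarith

lemma proj_id_on_vspan:
  assumes "orthonormal e s" "x \<in> vspan n e s"
  shows "proj e s x = x"
proof -
  obtain c where x: "x = lc n e c s" using assms(2) by (rule vspanE)
  show ?thesis unfolding proj_def x
    by (rule lc_cong) (simp_all add: orthonormal_coeff[OF assms(1)])
qed

lemma orthonormal_extend:
  assumes "orthonormal e s" "x \<in> carrier_vec n" "x \<noteq> 0\<^sub>v n" "\<And>i. i < e \<Longrightarrow> B (s i) x = 0"
  shows "orthonormal (Suc e) (s(e := of_real (1 / sqrt (N x)) \<cdot>\<^sub>v x))"
proof -
  have "N x \<noteq> 0" using N_eq_0[OF assms(2)] assms(3) by blast
  then have pos: "N x > 0" using N_nonneg[of x] by linarith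
  let ?a = "of_real (1 / sqrt (N x)) :: 'a"
  have "B (?a \<cdot>\<^sub>v x) (?a \<cdot>\<^sub>v x) = of_real (1 / sqrt (N x) * (1 / sqrt (N x)) * N x)"
    using assms(2) unfolding of_real_mult B_self[OF assms(2), symmetric]
    by (simp only: smult_left smult_right conjugate_of_real smult_carrier_vec mult.assoc)
  also have "1 / sqrt (N x) * (1 / sqrt (N x)) * N x = 1" using pos by simp
  finally have self: "B (?a \<cdot>\<^sub>v x) (?a \<cdot>\<^sub>v x) = 1" by simp
  have r: "B (s i) (?a \<cdot>\<^sub>v x) = 0" if "i < e" for i
    using that assms by (simp add: smult_right orthonormal_carrier)
  have l: "B (?a \<cdot>\<^sub>v x) (s i) = 0" if "i < e" for i
    using r[OF that] that assms conj_sym[of "s i" "?a \<cdot>\<^sub>v x"] by (simp add: orthonormal_carrier)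
  show ?thesis
    using assms(1,2) self r l by (auto simp: orthonormal_def less_Suc_eq)
qed

text \<open>Gram-Schmidt by induction on \<open>d\<close>. The residual of \<open>w d\<close> is
  normalized and appended only if it is nonzero, which is why \<open>e\<close> may be smaller than
  \<open>d\<close>.\<close>

lemma orthonormal_basis_exists:
  assumes "\<And>i. i < d \<Longrightarrow> w i \<in> carrier_vec n"
  shows "\<exists>e s. e \<le> d \<and> orthonormal e s \<and> vspan n e s = vspan n d w"
  using assms
proof (induction d)
  case 0
  show ?case by (rule exI[of _ 0], rule exI[of _ w]) (simp add: orthonormal_def)
next
  case (Suc d)
  have "\<exists>e s. e \<le> d \<and> orthonormal e s \<and> vspan n e s = vspan n d w"
    by (rule Suc.IH) (simp add: Suc.prems)
  then obtain e s where es: "e \<le> d" "orthonormal e s" "vspan n e s = vspan n d w"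
    by blast
  have wd: "w d \<in> carrier_vec n" using Suc.prems by simp
  have wi: "w i \<in> vspan n e s" if "i < d" for i
    using that es(3) Suc.prems[of i] by (simp add: vspan_mem)
  have sub: "vspan n d w \<subseteq> vspan n (Suc d) w"
    using Suc.prems by (intro vspan_mono vspan_mem) auto
  define x where "x = w d - proj e s (w d)"
  have xc: "x \<in> carrier_vec n" using wd by (simp add: x_def)
  have pin: "proj e s (w d) \<in> vspan n e s" by (simp add: proj_def)
  have wx: "w d = x + proj e s (w d)" using wd by (auto simp: x_def proj_def)
  show ?case
  proof (cases "x = 0\<^sub>v n")
    case True
    then have "w d \<in> vspan n e s" using wx pin by simp
    then have "vspan n (Suc d) w \<subseteq> vspan n e s"
      using wi by (intro vspan_mono) (auto simp: less_Suc_eq)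
    then show ?thesis using es sub by (intro exI[of _ e] exI[of _ s]) auto
  next
    case False
    define a where "a = (of_real (1 / sqrt (N x)) :: 'a)"
    define s' where "s' = s(e := a \<cdot>\<^sub>v x)"
    have orth: "B (s i) x = 0" if "i < e" for i
      using residual_orthogonal_lc[OF es(2) wd, of "\<lambda>j. if j = i then 1 else 0"] that es(2)
      by (simp add: x_def lc_delta orthonormal_carrier)
    have o: "orthonormal (Suc e) s'"
      using orthonormal_extend[OF es(2) xc False orth] by (simp add: s'_def a_def)
    have "N x \<noteq> 0" using N_eq_0[OF xc] False by blast
    then have a0: "a \<noteq> 0" by (simp add: a_def)
    have s'mem: "s' i \<in> vspan n (Suc e) s'" if "i < Suc e" for i
      using that o by (intro vspan_mem) (auto simp: orthonormal_carrier)
    have sub': "vspan n e s \<subseteq> vspan n (Suc e) s'"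
    proof (rule vspan_mono)
      fix i assume "i < e"
      then show "s i \<in> vspan n (Suc e) s'" using s'mem[of i] by (simp add: s'_def)
    qed
    have "x = (1 / a) \<cdot>\<^sub>v (s' e)" using a0 xc by (auto simp: s'_def)
    then have x': "x \<in> vspan n (Suc e) s'" using vspan_smult[OF s'mem[of e]] by simp
    have "vspan n (Suc d) w \<subseteq> vspan n (Suc e) s'"
    proof (rule vspan_mono)
      fix i assume "i < Suc d"
      moreover have "w d \<in> vspan n (Suc e) s'"
        using vspan_add[OF x', of "proj e s (w d)"] pin sub' wx by auto
      ultimately show "w i \<in> vspan n (Suc e) s'"
        using wi sub' by (auto simp: less_Suc_eq)
    qed
    moreover have "vspan n (Suc e) s' \<subseteq> vspan n (Suc d) w"
    proof (rule vspan_mono)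
      fix i assume i: "i < Suc e"
      have "w d \<in> vspan n (Suc d) w" using wd by (intro vspan_mem) auto
      then have "x \<in> vspan n (Suc d) w"
        unfolding x_def using pin es(3) sub by (intro vspan_diff) auto
      moreover have "s j \<in> vspan n (Suc d) w" if "j < e" for j
        using vspan_mem[of j e s n] that orthonormal_carrier[OF es(2) that] es(3) sub by auto
      ultimately show "s' i \<in> vspan n (Suc d) w"
        using i by (auto simp: s'_def less_Suc_eq vspan_smult)
    qed
    ultimately show ?thesis using es(1) o
      by (intro exI[of _ "Suc e"] exI[of _ s']) auto
  qed
qed

text \<open>Double counting of the squared moduli of \<open>B (s j) (v i)\<close>: summed over
  \<open>j\<close> first they give exactly \<open>p\<close>, since each \<open>v i\<close> lies in
  the span of \<open>s\<close>; summed over \<open>i\<close> first they give at most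
  \<open>e\<close> by Bessel.\<close>

lemma orthonormal_card_le:
  assumes "orthonormal p v" "orthonormal e s" "\<And>i. i < p \<Longrightarrow> v i \<in> vspan n e s"
  shows "p \<le> e"
proof -
  have one: "N (v i) = 1" if "i < p" for i
    using that assms(1) by (simp add: N_def orthonormal_def)
  have one': "N (s i) = 1" if "i < e" for i
    using that assms(2) by (simp add: N_def orthonormal_def)
  have "real p = (\<Sum>i<p. N (v i))" by (simp add: one)
  also have "\<dots> = (\<Sum>i<p. \<Sum>j<e. (norm (B (s j) (v i)))\<^sup>2)"
  proof (rule sum.cong)
    fix i assume "i \<in> {..<p}"
    then show "N (v i) = (\<Sum>j<e. (norm (B (s j) (v i)))\<^sup>2)"
      using N_lc[OF assms(2), of "\<lambda>j. B (s j) (v i)"] proj_id_on_vspan[OF assms(2), of "v i"] assms(3)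
      by (simp add: proj_def)
  qed simp
  also have "\<dots> = (\<Sum>j<e. \<Sum>i<p. (norm (B (s j) (v i)))\<^sup>2)" by (rule sum.swap)
  also have "\<dots> = (\<Sum>j<e. \<Sum>i<p. (norm (B (v i) (s j)))\<^sup>2)"
    using assms by (intro sum.cong) (auto simp: norm_sym orthonormal_carrier)
  also have "\<dots> \<le> (\<Sum>j<e. N (s j))"
    using assms by (intro sum_mono bessel) (auto simp: orthonormal_carrier)
  also have "\<dots> = real e" by (simp add: one')
  finally show ?thesis by simp
qed

text \<open>A nonzero residual of \<open>x\<close> could be normalized and appended to
  \<open>v\<close>, giving \<open>Suc l\<close> orthonormal vectors in a span with an orthonormal
  basis of at most \<open>d \<le> l\<close> vectors.\<close>

lemma orthonormal_complete:
  assumes "orthonormal l v" "\<And>i. i < d \<Longrightarrow> w i \<in> carrier_vec n"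
    "\<And>i. i < l \<Longrightarrow> v i \<in> vspan n d w" "d \<le> l" "x \<in> vspan n d w"
  shows "proj l v x = x"
proof (rule ccontr)
  assume neq: "proj l v x \<noteq> x"
  obtain e s where es: "e \<le> d" "orthonormal e s" "vspan n e s = vspan n d w"
    using orthonormal_basis_exists[of d w, OF assms(2)] by blast
  have xc: "x \<in> carrier_vec n" using assms(5) vspan_carrier by blast
  define y where "y = x - proj l v x"
  have y: "y \<in> carrier_vec n" "y \<in> vspan n d w"
    using xc assms(3,5) by (auto simp: y_def proj_def intro!: vspan_diff vspan_lc)
  have "y \<noteq> 0\<^sub>v n"
  proof
    assume "y = 0\<^sub>v n"
    moreover have "x = y + proj l v x" using xc by (auto simp: y_def proj_def)
    ultimately show False using neq by simp
  qed
  moreover have "B (v i) y = 0" if "i < l" for i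
    using residual_orthogonal_lc[OF assms(1) xc, of "\<lambda>j. if j = i then 1 else 0"] that assms(1)
    by (simp add: y_def lc_delta orthonormal_carrier)
  ultimately have "orthonormal (Suc l) (v(l := of_real (1 / sqrt (N y)) \<cdot>\<^sub>v y))"
    by (rule orthonormal_extend[OF assms(1) y(1)])
  then have "Suc l \<le> e"
    by (rule orthonormal_card_le[OF _ es(2)])
      (use es(3) assms(3) y(2) in \<open>auto simp: less_Suc_eq vspan_smult\<close>)
  then show False using es(1) assms(4) by simp
qed

end

subsection \<open>Deflation and the Eckart--Young inequality\<close>

text \<open>This is \<open>T\<^sup>H T = I\<close> for the matrix whose column \<open>i\<close> has
  the entries \<open>T i c\<close>.\<close>

definition coeff_orth :: "nat \<Rightarrow> nat \<Rightarrow> (nat \<Rightarrow> nat \<Rightarrow> 'a::rc_field) \<Rightarrow> bool" where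
  "coeff_orth m r T \<longleftrightarrow>
     (\<forall>i<r. \<forall>j<r. (\<Sum>c<m. conjugate (T i c) * T j c) = (if i = j then 1 else 0))"

lemma coeff_orth_mono: "coeff_orth m l T \<Longrightarrow> r \<le> l \<Longrightarrow> coeff_orth m r T"
  by (simp add: coeff_orth_def)

text \<open>Cyclicity of the trace: moving the sum over \<open>c\<close> inside produces
  \<open>T\<^sup>H T = I\<close>.\<close>

lemma coeff_orth_trace:
  assumes "coeff_orth m r T"
  shows "(\<Sum>c<m. \<Sum>i<r. \<Sum>j<r. T i c * conjugate (T j c) * \<beta> i j) = (\<Sum>i<r. \<beta> i i)"
proof -
  have "(\<Sum>c<m. \<Sum>i<r. \<Sum>j<r. T i c * conjugate (T j c) * \<beta> i j)
      = (\<Sum>i<r. \<Sum>c<m. \<Sum>j<r. T i c * conjugate (T j c) * \<beta> i j)"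
    by (rule sum.swap)
  also have "\<dots> = (\<Sum>i<r. \<Sum>j<r. \<Sum>c<m. T i c * conjugate (T j c) * \<beta> i j)"
    by (intro sum.cong refl sum.swap)
  also have "\<dots> = (\<Sum>i<r. \<Sum>j<r. (if j = i then 1 else 0) * \<beta> i j)"
  proof (intro sum.cong refl)
    fix i j assume ij: "i \<in> {..<r}" "j \<in> {..<r}"
    have "(\<Sum>c<m. T i c * conjugate (T j c) * \<beta> i j) = (\<Sum>c<m. conjugate (T j c) * T i c) * \<beta> i j"
      by (subst sum_distrib_right) (simp add: mult_ac)
    then show "(\<Sum>c<m. T i c * conjugate (T j c) * \<beta> i j) = (if j = i then 1 else 0) * \<beta> i j"
      using assms ij by (simp add: coeff_orth_def)
  qed
  also have "\<dots> = (\<Sum>i<r. \<beta> i i)"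
    by (intro sum.cong refl) (simp add: if_distrib[of "\<lambda>x. x * _"] cong: if_cong)
  finally show ?thesis .
qed

text \<open>Orthonormal columns act as an isometry on coefficient vectors; this is
  \<open>coeff_orth_trace\<close> for the rank-one matrix with entries
  \<open>conjugate (\<beta> i) * \<beta> j\<close>.\<close>

lemma coeff_orth_parseval:
  assumes "coeff_orth m l T"
  shows "(\<Sum>c<m. (norm (\<Sum>i<l. conjugate (T i c) * \<beta> i))\<^sup>2) = (\<Sum>i<l. (norm (\<beta> i))\<^sup>2)"
proof -
  have "of_real (\<Sum>c<m. (norm (\<Sum>i<l. conjugate (T i c) * \<beta> i))\<^sup>2)
      = (\<Sum>c<m. conjugate (\<Sum>i<l. conjugate (T i c) * \<beta> i) * (\<Sum>i<l. conjugate (T i c) * \<beta> i))"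
    unfolding conjugate_mult_self by simp
  also have "\<dots> = (\<Sum>c<m. \<Sum>i<l. \<Sum>j<l. T i c * conjugate (T j c) * (conjugate (\<beta> i) * \<beta> j))"
    unfolding sum_conjugate[OF finite_lessThan] sum_product conjugate_dist_mul conjugate_id
    by (simp only: mult_ac)
  also have "\<dots> = (\<Sum>i<l. conjugate (\<beta> i) * \<beta> i)"
    by (rule coeff_orth_trace[OF assms])
  also have "\<dots> = of_real (\<Sum>i<l. (norm (\<beta> i))\<^sup>2)"
    unfolding conjugate_mult_self by simp
  finally show ?thesis by (simp only: of_real_eq_iff)
qed

text \<open>Column \<open>c\<close> of \<open>X (I - T T\<^sup>H)\<close>, where the columns of \<open>X\<close> are \<open>x 0, \<dots>, x (m - 1)\<close> and
  column \<open>i\<close> of \<open>T\<close> has the entries \<open>T i 0, \<dots>, T i (m - 1)\<close>.\<close>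
definition defl :: "nat \<Rightarrow> nat \<Rightarrow> nat \<Rightarrow> (nat \<Rightarrow> nat \<Rightarrow> 'a::rc_field) \<Rightarrow> (nat \<Rightarrow> 'a vec) \<Rightarrow> nat \<Rightarrow> 'a vec"
  where "defl n m r T x c = x c - lc n r (\<lambda>i. conjugate (T i c)) (\<lambda>i. lc n m (T i) x)"

lemma defl_carrier [simp]: "x c \<in> carrier_vec n \<Longrightarrow> defl n m r T x c \<in> carrier_vec n"
  by (simp add: defl_def)

lemma defl_add:
  assumes "\<And>c. c < m \<Longrightarrow> p c \<in> carrier_vec n" "\<And>c. c < m \<Longrightarrow> q c \<in> carrier_vec n"
    "\<And>c. c < m \<Longrightarrow> x c = p c + q c" "c < m"
  shows "defl n m r T x c = defl n m r T p c + defl n m r T q c"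
proof -
  have "lc n m (T i) x = lc n m (T i) p + lc n m (T i) q" for i
    using lc_cong[of m "T i" "T i" x "\<lambda>c. p c + q c" n] assms(1-3) by (simp add: lc_family_add)
  then have "defl n m r T x c = p c + q c -
      (lc n r (\<lambda>i. conjugate (T i c)) (\<lambda>i. lc n m (T i) p) +
       lc n r (\<lambda>i. conjugate (T i c)) (\<lambda>i. lc n m (T i) q))"
    using assms(3,4) by (simp add: defl_def lc_family_add)
  then show ?thesis using assms(1,2)[OF assms(4)] by (auto simp: defl_def)
qed

text \<open>Associativity: \<open>M\<close> acts on the columns from the left, deflation mixes them
  from the right.\<close>

lemma mat_mult_defl:
  assumes "M \<in> carrier_mat k n" "\<And>c. c < m \<Longrightarrow> x c \<in> carrier_vec n" "c < m"
  shows "M *\<^sub>v defl n m r T x c = defl k m r T (\<lambda>c. M *\<^sub>v x c) c"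
proof -
  have "M *\<^sub>v lc n m (T i) x = lc k m (T i) (\<lambda>c. M *\<^sub>v x c)" for i
    using assms by (intro mat_mult_lc) auto
  then show ?thesis
    unfolding defl_def using assms by (simp add: mult_minus_distrib_mat_vec[of _ k n] mat_mult_lc[of _ k n])
qed

text \<open>Ky Fan's maximum principle, in scalar form.\<close>
lemma sum_weighted_le_sum_largest:
  fixes lam g :: "nat \<Rightarrow> real"
  assumes "0 < r" "r \<le> l" "\<And>i j. i \<le> j \<Longrightarrow> j < l \<Longrightarrow> lam j \<le> lam i" "\<And>i. i < l \<Longrightarrow> 0 \<le> lam i"
    "\<And>i. i < l \<Longrightarrow> 0 \<le> g i" "\<And>i. i < l \<Longrightarrow> g i \<le> 1" "(\<Sum>i<l. g i) \<le> real r"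
  shows "(\<Sum>i<l. lam i * g i) \<le> (\<Sum>i<r. lam i)"
proof -
  \<comment> \<open>The \<open>r\<close>-th largest value, at index \<open>r - 1\<close> because
    indices start at 0. After subtracting it, the terms before \<open>r\<close> are nonnegative and
    the others nonpositive, so the weights can be replaced by 1 and 0.\<close>
  define \<mu> where "\<mu> = lam (r - 1)"
  have \<mu>: "0 \<le> \<mu>" using assms(1,2,4) by (simp add: \<mu>_def)
  have "(\<Sum>i<l. (lam i - \<mu>) * g i) \<le> (\<Sum>i<l. if i < r then lam i - \<mu> else 0)"
  proof (rule sum_mono)
    fix i assume "i \<in> {..<l}"
    then have i: "i < l" by simp
    show "(lam i - \<mu>) * g i \<le> (if i < r then lam i - \<mu> else 0)"
    proof (cases "i < r")
      case True
      then have "\<mu> \<le> lam i" using assms(1,2,3) by (auto simp: \<mu>_def)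
      then show ?thesis using True assms(6)[OF i] by (simp add: mult_left_le)
    next
      case False
      then have "lam i \<le> \<mu>" using assms(3) i by (auto simp: \<mu>_def)
      then show ?thesis using False assms(5)[OF i] by (simp add: mult_nonpos_nonneg)
    qed
  qed
  also have "\<dots> = (\<Sum>i<r. lam i - \<mu>)"
    using assms(2) by (intro sum.mono_neutral_cong_right) auto
  finally have "(\<Sum>i<l. (lam i - \<mu>) * g i) \<le> (\<Sum>i<r. lam i) - \<mu> * real r"
    by (simp add: sum_subtractf mult.commute)
  moreover have "(\<Sum>i<l. (lam i - \<mu>) * g i) = (\<Sum>i<l. lam i * g i) - \<mu> * (\<Sum>i<l. g i)"
    by (simp add: left_diff_distrib sum_subtractf sum_distrib_left)
  \<comment> \<open>The weights sum to at most \<open>r\<close>, not exactly \<open>r\<close>, so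
    the sign of \<open>\<mu>\<close> matters.\<close>
  moreover have "\<mu> * (\<Sum>i<l. g i) \<le> \<mu> * real r" using \<mu> assms(7) by (rule mult_left_mono[rotated])
  ultimately show ?thesis by linarith
qed

context vec_inner
begin

text \<open>Expand the square of \<open>x c\<close> minus the subtracted column \<open>q c\<close>.
  Both cross sums and the sum of squares of \<open>q\<close> equal the same total over the
  \<open>z i\<close>, so one copy remains with a minus sign. In particular deflation never increases
  the sum of squares.\<close>

lemma sum_N_defl:
  assumes "\<And>c. c < m \<Longrightarrow> x c \<in> carrier_vec n" "coeff_orth m r T"
  shows "(\<Sum>c<m. N (defl n m r T x c)) = (\<Sum>c<m. N (x c)) - (\<Sum>i<r. N (lc n m (T i) x))"
proof -
  define z where "z i = lc n m (T i) x" for i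
  define q where "q c = lc n r (\<lambda>i. conjugate (T i c)) z" for c
  have zc: "z i \<in> carrier_vec n" for i by (simp add: z_def)
  have qc: "q c \<in> carrier_vec n" for c by (simp add: q_def)
  have qx: "(\<Sum>c<m. B (q c) (x c)) = (\<Sum>i<r. B (z i) (z i))"
  proof -
    have "(\<Sum>c<m. B (q c) (x c)) = (\<Sum>c<m. \<Sum>i<r. T i c * B (z i) (x c))"
      using assms(1) by (intro sum.cong) (auto simp: q_def lc_left zc)
    also have "\<dots> = (\<Sum>i<r. \<Sum>c<m. T i c * B (z i) (x c))" by (rule sum.swap)
    also have "\<dots> = (\<Sum>i<r. B (z i) (z i))"
      using assms(1) zc by (intro sum.cong refl) (subst (3) z_def, simp add: lc_right)
    finally show ?thesis .
  qed
  have xq: "(\<Sum>c<m. B (x c) (q c)) = (\<Sum>i<r. B (z i) (z i))"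
  proof -
    have "(\<Sum>c<m. B (x c) (q c)) = (\<Sum>c<m. conjugate (B (q c) (x c)))"
      using assms(1) qc by (intro sum.cong) (auto simp: conj_sym)
    also have "\<dots> = conjugate (\<Sum>i<r. B (z i) (z i))" by (simp add: sum_conjugate[symmetric] qx)
    also have "\<dots> = (\<Sum>i<r. B (z i) (z i))" using zc by (simp add: sum_conjugate conj_sym)
    finally show ?thesis .
  qed
  have qq: "(\<Sum>c<m. B (q c) (q c)) = (\<Sum>i<r. B (z i) (z i))"
  proof -
    have "(\<Sum>c<m. B (q c) (q c)) = (\<Sum>c<m. \<Sum>i<r. \<Sum>j<r. T i c * conjugate (T j c) * B (z i) (z j))"
    proof (intro sum.cong refl)
      fix c
      have "B (q c) (q c) = (\<Sum>i<r. T i c * B (z i) (q c))"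
        using qc zc by (subst q_def) (simp add: lc_left)
      also have "\<dots> = (\<Sum>i<r. \<Sum>j<r. T i c * conjugate (T j c) * B (z i) (z j))"
        using zc by (simp add: q_def lc_right sum_distrib_left mult.assoc)
      finally show "B (q c) (q c) = (\<Sum>i<r. \<Sum>j<r. T i c * conjugate (T j c) * B (z i) (z j))" .
    qed
    then show ?thesis by (simp add: coeff_orth_trace[OF assms(2)])
  qed
  have "of_real (\<Sum>c<m. N (defl n m r T x c)) = (\<Sum>c<m. B (x c - q c) (x c - q c))"
    unfolding of_real_sum using assms(1) qc
    by (intro sum.cong refl) (simp add: B_self defl_def q_def z_def[abs_def])
  also have "\<dots> = (\<Sum>c<m. B (x c) (x c) - B (x c) (q c) - (B (q c) (x c) - B (q c) (q c)))"
    using assms(1) qc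
    by (intro sum.cong refl) (simp add: minus_left minus_right)
  also have "\<dots> = (\<Sum>c<m. B (x c) (x c)) - (\<Sum>i<r. B (z i) (z i))"
    by (simp only: sum_subtractf qx xq qq) simp
  also have "\<dots> = of_real ((\<Sum>c<m. N (x c)) - (\<Sum>i<r. N (z i)))"
    using assms(1) zc by (simp add: B_self)
  finally show ?thesis by (simp only: of_real_eq_iff z_def)
qed

text \<open>The assumption on \<open>lam\<close> is the conjugated entry \<open>c\<close> of the
  eigenvector equation for the Gram matrix. Expanding the second argument leaves
  \<open>lam i\<close> times the inner product of two coefficient columns.\<close>

lemma gram_eigenvectors_orthogonal:
  assumes "\<And>c. c < m \<Longrightarrow> a c \<in> carrier_vec n" "coeff_orth m l T"
    "\<And>c. c < m \<Longrightarrow> B (lc n m (T i) a) (a c) = of_real (lam i) * conjugate (T i c)"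
    "i < l" "j < l"
  shows "B (lc n m (T i) a) (lc n m (T j) a) = (if i = j then of_real (lam i) else 0)"
proof -
  have "B (lc n m (T i) a) (lc n m (T j) a) = (\<Sum>c<m. T j c * (of_real (lam i) * conjugate (T i c)))"
    using assms(1,3) by (subst lc_right) (auto intro!: sum.cong)
  also have "\<dots> = of_real (lam i) * (\<Sum>c<m. conjugate (T i c) * T j c)"
    by (simp add: sum_distrib_left mult_ac)
  finally show ?thesis using assms(2,4,5) by (simp add: coeff_orth_def)
qed

text \<open>Eckart--Young in the Frobenius norm. The hypotheses on \<open>w\<close> say that the family \<open>a\<close> has rank at
  most \<open>l\<close>, so that the \<open>l\<close> given eigenpairs of its Gram matrix capture it completely.\<close>
lemma defl_optimal:
  assumes a: "\<And>c. c < m \<Longrightarrow> a c \<in> carrier_vec n" and T: "coeff_orth m l T"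
    and eig: "\<And>i c. i < l \<Longrightarrow> c < m \<Longrightarrow>
        B (lc n m (T i) a) (a c) = of_real (lam i) * conjugate (T i c)"
    and lam: "\<And>i. i < l \<Longrightarrow> lam i > 0" "\<And>i j. i \<le> j \<Longrightarrow> j < l \<Longrightarrow> lam j \<le> lam i"
    and w: "\<And>i. i < l \<Longrightarrow> w i \<in> carrier_vec n" "vspan n l w = vspan n m a"
    and r: "0 < r" "r \<le> l" "e \<le> r"
    and s: "orthonormal e s" "\<And>c. c < m \<Longrightarrow> b c \<in> vspan n e s"
  shows "(\<Sum>c<m. N (defl n m r T a c)) \<le> (\<Sum>c<m. N (a c - b c))"
proof -
  define z where "z i = lc n m (T i) a" for i
  \<comment> \<open>The left singular vectors of the family \<open>a\<close>; the singular values
    are \<open>sqrt (lam i)\<close>.\<close>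
  define v where "v i = of_real (1 / sqrt (lam i)) \<cdot>\<^sub>v z i" for i
  have zc: "z i \<in> carrier_vec n" for i by (simp add: z_def)
  have vc: "v i \<in> carrier_vec n" for i using zc by (simp add: v_def)
  have sc: "s j \<in> carrier_vec n" if "j < e" for j using orthonormal_carrier[OF s(1) that] .
  have zz: "B (z i) (z j) = (if i = j then of_real (lam i) else 0)" if "i < l" "j < l" for i j
    unfolding z_def using a T eig[OF that(1)] that by (rule gram_eigenvectors_orthogonal)
  have Nz: "N (z i) = lam i" if "i < l" for i
    using zz[OF that that] lam(1)[OF that] by (simp add: N_def)
  have inv: "of_real (1 / sqrt (lam i)) * (of_real (1 / sqrt (lam i)) * of_real (lam i)) = (1::'a)"
    if "i < l" for i
  proof -
    have "1 / sqrt (lam i) * (1 / sqrt (lam i) * lam i) = 1" using lam(1)[OF that] by simp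
    then show ?thesis by (metis of_real_1 of_real_mult)
  qed
  have ov: "orthonormal l v"
    unfolding orthonormal_def
  proof (intro conjI allI impI)
    fix i j assume ij: "i < l" "j < l"
    have "B (v i) (v j) = of_real (1 / sqrt (lam i)) * (of_real (1 / sqrt (lam j)) * B (z i) (z j))"
      using zc unfolding v_def by (simp only: smult_left smult_right smult_carrier_vec conjugate_of_real mult_ac)
    then show "B (v i) (v j) = (if i = j then 1 else 0)"
      using zz[OF ij] inv[OF ij(2)] by (simp del: of_real_divide)
  qed (rule vc)
  \<comment> \<open>The singular value decomposition \<open>A = Z T\<^sup>H\<close>. It holds
    because the \<open>l\<close> orthonormal vectors \<open>v\<close> exhaust the span of
    \<open>a\<close>, which has \<open>l\<close> generators.\<close>
  have expand: "a c = lc n l (\<lambda>i. conjugate (T i c)) z" if c: "c < m" for c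
  proof -
    have "proj l v (a c) = a c"
    proof (rule orthonormal_complete[OF ov w(1)])
      show "v i \<in> vspan n l w" for i by (simp add: w(2) v_def z_def vspan_smult)
      show "a c \<in> vspan n l w" using c a by (simp add: w(2) vspan_mem)
    qed auto
    moreover have "proj l v (a c) = lc n l (\<lambda>i. conjugate (T i c)) z"
      unfolding proj_def
    proof (rule eq_vecI)
      fix b assume "b < dim_vec (lc n l (\<lambda>i. conjugate (T i c)) z)"
      then have b: "b < n" by simp
      have "B (v i) (a c) * v i $ b = conjugate (T i c) * z i $ b" if i: "i < l" for i
      proof -
        have "B (v i) (a c) * v i $ b = (of_real (1 / sqrt (lam i)) * (of_real (1 / sqrt (lam i)) * of_real (lam i)))
            * (conjugate (T i c) * z i $ b)"
          using zc[of i] a[OF c] b eig[OF i c] unfolding v_def z_def[symmetric]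
          by (simp add: smult_left mult_ac del: of_real_divide)
        then show ?thesis by (simp only: inv[OF i] mult_1_left)
      qed
      then show "lc n l (\<lambda>i. B (v i) (a c)) v $ b = lc n l (\<lambda>i. conjugate (T i c)) z $ b"
        using b by (simp add: lc_def)
    qed simp
    ultimately show ?thesis by simp
  qed
  \<comment> \<open>The squared length of the projection of \<open>v i\<close> to the span of
    \<open>s\<close>; these are the weights for Ky Fan's principle.\<close>
  define g where "g i = (\<Sum>j<e. (norm (B (s j) (v i)))\<^sup>2)" for i
  have Bsz: "(norm (B (s j) (z i)))\<^sup>2 = lam i * (norm (B (s j) (v i)))\<^sup>2" if "i < l" "j < e" for i j
  proof -
    have "B (s j) (v i) = of_real (1 / sqrt (lam i)) * B (s j) (z i)"
      using zc sc[OF that(2)] by (simp add: v_def smult_right)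
    then have "norm (B (s j) (v i)) = norm (B (s j) (z i)) / sqrt (lam i)"
      using lam(1)[OF that(1)] by (simp add: norm_mult norm_divide)
    then show ?thesis using lam(1)[OF that(1)] by (simp add: power_divide)
  qed
  \<comment> \<open>The part of \<open>a\<close> captured by \<open>s\<close>: Parseval for
    \<open>T\<close> removes the sum over columns and leaves the eigenvalues weighted by
    \<open>g\<close>.\<close>
  have "(\<Sum>c<m. \<Sum>j<e. (norm (B (s j) (a c)))\<^sup>2) = (\<Sum>j<e. \<Sum>c<m. (norm (B (s j) (a c)))\<^sup>2)"
    by (rule sum.swap)
  also have "\<dots> = (\<Sum>j<e. \<Sum>i<l. (norm (B (s j) (z i)))\<^sup>2)"
  proof (rule sum.cong[OF refl])
    fix j assume "j \<in> {..<e}"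
    then have j: "j < e" by simp
    have "(\<Sum>c<m. (norm (B (s j) (a c)))\<^sup>2) = (\<Sum>c<m. (norm (\<Sum>i<l. conjugate (T i c) * B (s j) (z i)))\<^sup>2)"
    proof (intro sum.cong refl)
      fix c assume "c \<in> {..<m}"
      then have c: "c < m" by simp
      show "(norm (B (s j) (a c)))\<^sup>2 = (norm (\<Sum>i<l. conjugate (T i c) * B (s j) (z i)))\<^sup>2"
        by (subst expand[OF c]) (simp add: lc_right sc[OF j] zc)
    qed
    then show "(\<Sum>c<m. (norm (B (s j) (a c)))\<^sup>2) = (\<Sum>i<l. (norm (B (s j) (z i)))\<^sup>2)"
      by (simp add: coeff_orth_parseval[OF T])
  qed
  also have "\<dots> = (\<Sum>j<e. \<Sum>i<l. lam i * (norm (B (s j) (v i)))\<^sup>2)"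
    by (intro sum.cong refl) (simp add: Bsz)
  also have "\<dots> = (\<Sum>i<l. lam i * g i)"
    by (subst sum.swap) (simp add: g_def sum_distrib_left)
  also have "\<dots> \<le> (\<Sum>i<r. lam i)"
  proof (rule sum_weighted_le_sum_largest[OF r(1,2)])
    show "lam j \<le> lam i" if "i \<le> j" "j < l" for i j using lam(2) that by simp
    show "0 \<le> lam i" if "i < l" for i using lam(1)[OF that] by simp
    show "0 \<le> g i" for i by (simp add: g_def sum_nonneg)
    show "g i \<le> 1" if "i < l" for i
    proof -
      have "N (v i) = 1" using ov that by (simp add: N_def orthonormal_def)
      then show ?thesis using bessel[OF s(1) vc[of i]] by (simp add: g_def)
    qed
    \<comment> \<open>With the roles of \<open>s\<close> and \<open>v\<close> exchanged, Bessel for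
      \<open>v\<close> bounds the total weight by \<open>e\<close>, hence by
      \<open>r\<close>.\<close>
    have "(\<Sum>i<l. g i) = (\<Sum>j<e. \<Sum>i<l. (norm (B (s j) (v i)))\<^sup>2)"
      unfolding g_def by (rule sum.swap)
    also have "\<dots> = (\<Sum>j<e. \<Sum>i<l. (norm (B (v i) (s j)))\<^sup>2)"
      using norm_sym[OF sc vc] by (intro sum.cong refl) simp
    also have "\<dots> \<le> (\<Sum>j<e. N (s j))"
      using sc by (intro sum_mono bessel[OF ov]) auto
    also have "\<dots> = (\<Sum>j<e. 1)"
      using s(1) by (intro sum.cong refl) (simp add: N_def orthonormal_def)
    also have "\<dots> \<le> real r" using r(3) by simp
    finally show "(\<Sum>i<l. g i) \<le> real r" .
  qed
  finally have fan: "(\<Sum>c<m. \<Sum>j<e. (norm (B (s j) (a c)))\<^sup>2) \<le> (\<Sum>i<r. lam i)" .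
  \<comment> \<open>Deflation removes the \<open>r\<close> largest eigenvalues from the total;
    approximation from the span of \<open>s\<close> removes at most the captured part.\<close>
  have "(\<Sum>c<m. N (defl n m r T a c)) = (\<Sum>c<m. N (a c)) - (\<Sum>i<r. N (z i))"
    unfolding z_def using a coeff_orth_mono[OF T r(2)] by (rule sum_N_defl)
  also have "\<dots> = (\<Sum>c<m. N (a c)) - (\<Sum>i<r. lam i)"
    using r(2) by (simp add: Nz)
  also have "\<dots> \<le> (\<Sum>c<m. N (a c)) - (\<Sum>c<m. \<Sum>j<e. (norm (B (s j) (a c)))\<^sup>2)"
    using fan by simp
  also have "\<dots> = (\<Sum>c<m. N (a c) - (\<Sum>j<e. (norm (B (s j) (a c)))\<^sup>2))"
    by (simp add: sum_subtractf)
  also have "\<dots> \<le> (\<Sum>c<m. N (a c - b c))"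
  proof (rule sum_mono)
    fix c assume "c \<in> {..<m}"
    then have c: "c < m" by simp
    obtain \<beta> where \<beta>: "b c = lc n e \<beta> s" using s(2)[OF c] by (rule vspanE)
    have "0 \<le> (\<Sum>j<e. (norm (B (s j) (a c) - \<beta> j))\<^sup>2)" by (simp add: sum_nonneg)
    then show "N (a c) - (\<Sum>j<e. (norm (B (s j) (a c)))\<^sup>2) \<le> N (a c - b c)"
      using N_minus_lc[OF s(1) a[OF c], of \<beta>] N_proj_pythagoras[OF s(1) a[OF c]]
      unfolding \<beta> by linarith
  qed
  finally show ?thesis .
qed

end

subsection \<open>The sketched method of snapshots\<close>

lemma ip_sum:
  "\<lbrakk>x \<in> carrier_vec n; y \<in> carrier_vec n\<rbrakk> \<Longrightarrow> ip x y = (\<Sum>i<n. conjugate (x $ i) * y $ i)"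
  by (auto simp: ip_def scalar_prod_def atLeast0LessThan intro!: sum.cong)

lemma ip_self: "x \<in> carrier_vec n \<Longrightarrow> ip x x = of_real (\<Sum>i<n. (norm (x $ i :: 'a::rc_field))\<^sup>2)"
  by (simp add: ip_sum[of x n] conjugate_mult_self)

lemma vec_inner_ip: "vec_inner n (ip :: 'a::rc_field vec \<Rightarrow> _)"
proof
  fix x y z :: "'a vec" and a :: 'a
  assume x: "x \<in> carrier_vec n" and y: "y \<in> carrier_vec n"
  show "ip x (a \<cdot>\<^sub>v y) = a * ip x y"
    using x y by (simp add: ip_sum[of _ n] sum_distrib_left mult_ac)
  show "conjugate (ip x y) = ip y x"
    using x y by (simp add: ip_sum[of _ n] sum_conjugate conjugate_dist_mul mult.commute)
  assume z: "z \<in> carrier_vec n"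
  show "ip x (y + z) = ip x y + ip x z"
    using x y z by (simp add: ip_sum[of _ n] distrib_left sum.distrib)
next
  fix x :: "'a vec" assume x: "x \<in> carrier_vec n"
  have "norm (of_real (\<Sum>i<n. (norm (x $ i))\<^sup>2) :: 'a) = (\<Sum>i<n. (norm (x $ i))\<^sup>2)"
    by (simp only: norm_of_real) (simp add: sum_nonneg)
  then show "ip x x = of_real (norm (ip x x))" using ip_self[OF x] by simp
  assume "ip x x = 0"
  then have "(\<Sum>i<n. (norm (x $ i))\<^sup>2) = 0" using ip_self[OF x] by (simp only: of_real_eq_0_iff)
  then have "\<forall>i<n. x $ i = 0" by (simp add: sum_nonneg_eq_0_iff)
  then show "x = 0\<^sub>v n" using x by (intro eq_vecI) auto
qed

lemma ip_adjoint:
  fixes M :: "'a::rc_field mat"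
  assumes "M \<in> carrier_mat k n" "x \<in> carrier_vec k" "y \<in> carrier_vec n"
  shows "ip (mat_adjoint M *\<^sub>v x) y = ip x (M *\<^sub>v y)"
proof -
  have adj: "(mat_adjoint M *\<^sub>v x) $ b = (\<Sum>a<k. conjugate (M $$ (a, b)) * x $ a)" if "b < n" for b
    using assms that
    by (auto simp: mat_adjoint_def scalar_prod_def atLeast0LessThan intro!: sum.cong)
  have dim: "mat_adjoint M *\<^sub>v x \<in> carrier_vec n"
    using assms by (auto simp: mat_adjoint_def intro!: carrier_vecI)
  have "ip (mat_adjoint M *\<^sub>v x) y
      = (\<Sum>b<n. conjugate (\<Sum>a<k. conjugate (M $$ (a, b)) * x $ a) * y $ b)"
    using assms(3) dim by (simp add: ip_sum[of _ n] adj)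
  also have "\<dots> = (\<Sum>b<n. \<Sum>a<k. conjugate (x $ a) * (M $$ (a, b) * y $ b))"
    unfolding sum_conjugate[OF finite_lessThan] sum_distrib_right conjugate_dist_mul conjugate_id
    by (simp only: mult_ac)
  also have "\<dots> = (\<Sum>a<k. \<Sum>b<n. conjugate (x $ a) * (M $$ (a, b) * y $ b))" by (rule sum.swap)
  also have "\<dots> = ip x (M *\<^sub>v y)"
    using assms by (subst ip_sum[of _ k])
      (auto simp: scalar_prod_def atLeast0LessThan sum_distrib_left intro!: sum.cong)
  finally show ?thesis .
qed

text \<open>Conjugate symmetry comes from moving the self-adjoint \<open>R\<close> across
  \<open>ip\<close>. Positive definiteness is stated for nonzero vectors, hence the separate check
  at zero.\<close>

lemma vec_inner_ipU:
  fixes R :: "'a::rc_field mat"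
  assumes "hermitian_pd n R"
  shows "vec_inner n (ipU R)"
proof -
  interpret E: vec_inner n "ip :: 'a vec \<Rightarrow> _" by (rule vec_inner_ip)
  have R: "R \<in> carrier_mat n n" "mat_adjoint R = R"
    and pd: "\<And>x. x \<in> carrier_vec n \<Longrightarrow> x \<noteq> 0\<^sub>v n \<Longrightarrow> \<exists>t::real. t > 0 \<and> ip (R *\<^sub>v x) x = of_real t"
    using assms by (auto simp: hermitian_pd_def)
  have Rx: "R *\<^sub>v x \<in> carrier_vec n" if "x \<in> carrier_vec n" for x using R(1) that by simp
  show ?thesis
  proof
    fix x y z :: "'a vec" and a :: 'a
    assume x: "x \<in> carrier_vec n" and y: "y \<in> carrier_vec n"
    show "ipU R x (a \<cdot>\<^sub>v y) = a * ipU R x y"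
      using E.smult_right[OF Rx[OF x] y] by (simp add: ipU_def)
    show "conjugate (ipU R x y) = ipU R y x"
      using ip_adjoint[OF R(1) x y] E.conj_sym[OF x Rx[OF y]] R(2)
      by (simp add: ipU_def)
    assume z: "z \<in> carrier_vec n"
    show "ipU R x (y + z) = ipU R x y + ipU R x z"
      using E.add_right[OF Rx[OF x] y z] by (simp add: ipU_def)
  next
    fix x :: "'a vec" assume x: "x \<in> carrier_vec n"
    have R0: "ip (R *\<^sub>v 0\<^sub>v n) (0\<^sub>v n) = 0" using Rx by simp
    show "ipU R x x = of_real (norm (ipU R x x))"
      using pd[OF x] R0 by (cases "x = 0\<^sub>v n") (auto simp: ipU_def)
    assume "ipU R x x = 0"
    then show "x = 0\<^sub>v n" using pd[OF x] by (auto simp: ipU_def)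
  qed
qed

text \<open>\<open>projU\<close> is a definite description. Projection along an orthonormal basis
  gives existence; two candidates differ by a vector of the subspace that is orthogonal to itself,
  which gives uniqueness.\<close>

lemma projU_vspan:
  fixes R :: "'a::rc_field mat"
  assumes R: "hermitian_pd n R" and w: "\<And>i. i < d \<Longrightarrow> w i \<in> carrier_vec n"
    and x: "x \<in> carrier_vec n"
  shows "projU R (vspan n d w) x \<in> vspan n d w"
    and "v \<in> vspan n d w \<Longrightarrow> ipU R v (x - projU R (vspan n d w) x) = 0"
proof -
  interpret vec_inner n "ipU R" by (rule vec_inner_ipU[OF R])
  let ?W = "vspan n d w"
  obtain e s where es: "orthonormal e s" "vspan n e s = ?W"
    using orthonormal_basis_exists[of d w, OF w] by blast
  let ?P = "\<lambda>p. p \<in> ?W \<and> (\<forall>v\<in>?W. ipU R v (x - p) = 0)"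
  have ex: "?P (proj e s x)"
    using residual_orthogonal_lc[OF es(1) x] unfolding es(2)[symmetric]
    by (auto simp: proj_def elim!: vspanE)
  have "p = proj e s x" if p: "?P p" for p
  proof -
    let ?q = "proj e s x"
    have pc: "p \<in> carrier_vec n" using p vspan_carrier by blast
    have "p - ?q \<in> ?W" using p ex by (auto intro: vspan_diff)
    then have "ipU R (p - ?q) (x - ?q) - ipU R (p - ?q) (x - p) = 0"
      using p ex by simp
    then have "ipU R (p - ?q) (p - ?q) = 0"
      using pc x by (simp add: minus_right)
    then have "p - ?q = 0\<^sub>v n" using pc by (intro definite) auto
    moreover have "p = (p - ?q) + ?q" using pc by (auto simp: proj_def)
    ultimately show ?thesis by simp
  qed
  then have "projU R ?W x = proj e s x"
    unfolding projU_def using ex by (rule the_equality[rotated])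
  then show "projU R ?W x \<in> ?W" and "v \<in> ?W \<Longrightarrow> ipU R v (x - projU R ?W x) = 0"
    using ex by simp_all
qed

text \<open>The rank is the dimension of the column space. This supplies the \<open>l\<close>
  generators that \<open>defl_optimal\<close> asks for.\<close>

lemma mrange_vec_space_rank:
  fixes A :: "'a::field mat"
  assumes A: "A \<in> carrier_mat k m"
  obtains D w where "D = vec_space.rank k A" "\<forall>i<D. w i \<in> carrier_vec k" "mrange A = vspan k D w"
proof -
  interpret V: vec_space "TYPE('a)" k .
  have cols: "set (cols A) \<subseteq> carrier_vec k" using A cols_dim by blast
  have "mrange A = V.col_space A" using A by (auto simp: V.col_space_eq[OF A] mrange_def)
  then have mr: "mrange A = V.span (set (cols A))" by (simp add: V.col_space_def)
  then have sub: "is_subspace k (mrange A)"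
    using V.span_is_subspace[of "set (cols A)"] cols by (simp add: is_subspace_def)
  have "sdim k (mrange A) = V.rank A" by (simp add: mr sdim_def V.rank_def)
  then show thesis using that by (auto intro: is_subspace_vspan_dim[OF sub])
qed

text \<open>Take both arguments equal to \<open>x\<close>, so that the two factors
  \<open>normU R x\<close> multiply to the squared norm, and apply the reverse triangle
  inequality.\<close>

lemma eps_embedding_bounds:
  fixes R Th :: "'a::rc_field mat"
  assumes "hermitian_pd n R" "Th \<in> carrier_mat k n" "eps_embedding R Th \<epsilon> V"
    "x \<in> V" "x \<in> carrier_vec n"
  shows "(1 - \<epsilon>) * norm (ipU R x x) \<le> norm (ip (Th *\<^sub>v x) (Th *\<^sub>v x))"
    and "norm (ip (Th *\<^sub>v x) (Th *\<^sub>v x)) \<le> (1 + \<epsilon>) * norm (ipU R x x)"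
proof -
  let ?a = "norm (ipU R x x)" and ?b = "norm (ip (Th *\<^sub>v x) (Th *\<^sub>v x))"
  have "norm (ipU R x x - ip (Th *\<^sub>v x) (Th *\<^sub>v x)) \<le> \<epsilon> * ?a"
    using assms(3,4) by (force simp: eps_embedding_def normU_def mult.assoc)
  moreover have "\<bar>?a - ?b\<bar> \<le> norm (ipU R x x - ip (Th *\<^sub>v x) (Th *\<^sub>v x))"
    by (rule norm_triangle_ineq3)
  ultimately show "(1 - \<epsilon>) * ?a \<le> ?b" "?b \<le> (1 + \<epsilon>) * ?a"
    by (auto simp: algebra_simps)
qed

section \<open>Sketched snapshots, their eigenpairs and the residuals\<close>

locale sketched_snapshots =
  fixes n k m r l :: nat and R Th :: "'a::rc_field mat" and us t :: "nat \<Rightarrow> 'a vec"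
    and lam :: "nat \<Rightarrow> real"
  assumes R: "hermitian_pd n R" and us: "\<And>c. c < m \<Longrightarrow> us c \<in> carrier_vec n"
    and Th: "Th \<in> carrier_mat k n" and pairs: "sk_eigenpairs n k m Th us l lam t"
    and r: "0 < r" "r \<le> l"
begin

sublocale U: vec_inner n "ipU R" by (rule vec_inner_ipU[OF R])
sublocale E: vec_inner k ip by (rule vec_inner_ip)

text \<open>In matrix terms \<open>a\<close> lists the columns of \<open>\<Theta> U\<^sub>m\<close>,
  \<open>T\<close> the entries of the eigenvectors, and \<open>d\<close> the columns of
  \<open>D\<close>.\<close>

definition a :: "nat \<Rightarrow> 'a vec" where "a c = Th *\<^sub>v us c"
definition T :: "nat \<Rightarrow> nat \<Rightarrow> 'a" where "T i c = t i $ c"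
definition d :: "nat \<Rightarrow> 'a vec" where "d c = defl n m r T us c"
abbreviation Ur where "Ur \<equiv> sk_Ur n m us t r"

lemma a_carrier: "c < m \<Longrightarrow> a c \<in> carrier_vec k"
  using us Th by (simp add: a_def)

lemma d_carrier: "c < m \<Longrightarrow> d c \<in> carrier_vec n"
  using us by (simp add: d_def)

lemma t_carrier: "i < l \<Longrightarrow> t i \<in> carrier_vec m"
  using pairs by (simp add: sk_eigenpairs_def)

lemma T_orth: "coeff_orth m l T"
  using pairs t_carrier by (auto simp: sk_eigenpairs_def coeff_orth_def T_def ip_sum[of _ m])

lemma mult_snap_mat: "Th * snap_mat n m us = snap_mat k m a"
proof (rule eq_matI)
  fix i j assume ij: "i < dim_row (snap_mat k m a)" "j < dim_col (snap_mat k m a)"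
  then have "col (snap_mat n m us) j = us j"
    using us by (simp add: snap_mat_def col_mat_of_cols)
  then show "(Th * snap_mat n m us) $$ (i, j) = snap_mat k m a $$ (i, j)"
    using ij Th by (simp add: snap_mat_def mat_of_cols_index a_def)
qed (use Th in \<open>auto simp: snap_mat_def\<close>)

lemma snap_mat_mult_t:
  assumes "i < l"
  shows "snap_mat n m us *\<^sub>v t i = lc n m (T i) us" "snap_mat k m a *\<^sub>v t i = lc k m (T i) a"
  using t_carrier[OF assms] by (simp_all add: snap_mat_def mat_of_cols_mult_vec T_def[abs_def])

text \<open>Entry \<open>c\<close> of \<open>A\<^sup>H (A t)\<close> is the inner product of column
  \<open>c\<close> of \<open>A\<close> with \<open>A t\<close>; conjugation swaps the arguments into
  the form used by the Eckart-Young lemma.\<close>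

lemma sketched_gram_eigenvector:
  assumes i: "i < l" and c: "c < m"
  shows "ip (lc k m (T i) a) (a c) = of_real (lam i) * conjugate (T i c)"
proof -
  let ?A = "snap_mat k m a"
  have A: "?A \<in> carrier_mat k m" unfolding snap_mat_def by (rule carrier_matI) simp_all
  have adj: "mat_adjoint ?A \<in> carrier_mat m k" using A by (auto simp: mat_adjoint_def)
  have "(mat_adjoint ?A * ?A) *\<^sub>v t i = of_real (lam i) \<cdot>\<^sub>v t i"
    using pairs i by (simp add: sk_eigenpairs_def sk_gram_def mult_snap_mat)
  then have "mat_adjoint ?A *\<^sub>v (lc k m (T i) a) = of_real (lam i) \<cdot>\<^sub>v t i"
    using assoc_mult_mat_vec[OF adj A t_carrier[OF i]] by (simp add: snap_mat_mult_t[OF i])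
  moreover have "(mat_adjoint ?A *\<^sub>v (lc k m (T i) a)) $ c = ip (a c) (lc k m (T i) a)"
    using c A a_carrier[OF c] by (simp add: mat_adjoint_def snap_mat_def ip_def)
  ultimately have "ip (a c) (lc k m (T i) a) = of_real (lam i) * T i c"
    using t_carrier[OF i] c by (simp add: T_def)
  then show ?thesis using E.conj_sym[of "a c" "lc k m (T i) a"] a_carrier[OF c]
    by (simp add: conjugate_dist_mul)
qed

lemma sketched_modes_orthogonal:
  assumes "i < l" "j < l"
  shows "ip (lc k m (T i) a) (lc k m (T j) a) = (if i = j then of_real (lam i) else 0)"
  using a_carrier T_orth sketched_gram_eigenvector[OF assms(1)] assms by (rule E.gram_eigenvectors_orthogonal)

text \<open>Each eigenvalue is the squared norm of the sketched mode, hence nonnegative, and it is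
  nonzero by the choice of eigenpairs.\<close>

lemma lam_pos:
  assumes "i < l"
  shows "lam i > 0"
proof -
  have "of_real (lam i) = (of_real (E.N (lc k m (T i) a)) :: 'a)"
    using sketched_modes_orthogonal[OF assms assms] E.B_self[of "lc k m (T i) a"] by simp
  then have "lam i = E.N (lc k m (T i) a)" by (simp only: of_real_eq_iff)
  moreover have "lam i \<noteq> 0" using pairs assms by (simp add: sk_eigenpairs_def)
  ultimately show ?thesis using E.N_nonneg[of "lc k m (T i) a"] by linarith
qed

lemma Ur_vspan: "Ur = vspan n r (\<lambda>i. lc n m (T i) us)"
proof -
  have "snap_mat n m us * mat_of_cols m (map t [0..<r]) = mat_of_cols n (map (\<lambda>i. lc n m (T i) us) [0..<r])"
  proof (rule eq_matI)
    fix i j assume ij: "i < dim_row (mat_of_cols n (map (\<lambda>i. lc n m (T i) us) [0..<r]))"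
      "j < dim_col (mat_of_cols n (map (\<lambda>i. lc n m (T i) us) [0..<r]))"
    then have j: "j < l" "j < r" and i: "i < n" using r by auto
    then have "col (mat_of_cols m (map t [0..<r])) j = t j"
      using t_carrier by (simp add: col_mat_of_cols)
    then show "(snap_mat n m us * mat_of_cols m (map t [0..<r])) $$ (i, j) =
        mat_of_cols n (map (\<lambda>i. lc n m (T i) us) [0..<r]) $$ (i, j)"
      using i j arg_cong[OF snap_mat_mult_t(1)[OF j(1)], of "\<lambda>x. x $ i"]
      by (simp add: mat_of_cols_index snap_mat_def)
  qed (auto simp: snap_mat_def)
  then show ?thesis by (simp add: sk_Ur_def mrange_mat_of_cols)
qed

lemma d_eq: "d c = us c - lc n r (\<lambda>i. conjugate (T i c)) (\<lambda>i. lc n m (T i) us)"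
  by (simp add: d_def defl_def)

lemma Th_d: "c < m \<Longrightarrow> Th *\<^sub>v d c = defl k m r T a c"
  unfolding d_def a_def[abs_def] using Th us by (rule mat_mult_defl)

lemma pod_err_eq: "pod_err R m us V = (1 / real m) * (\<Sum>c<m. U.N (us c - projU R V (us c)))"
  by (simp add: pod_err_def normU_def U.N_def)

text \<open>The sketched modes \<open>?z i\<close> span the image of \<open>U\<^sub>r\<close>.
  Against \<open>?z i\<close>, the column \<open>a c\<close> and the combination subtracted from it
  both give \<open>lam i * conjugate (T i c)\<close>, so the difference vanishes.\<close>

lemma Th_d_orthogonal_Ur:
  assumes c: "c < m" and v: "v \<in> Ur"
  shows "ip (Th *\<^sub>v d c) (Th *\<^sub>v v) = 0"
proof -
  let ?z = "\<lambda>i. lc k m (T i) a"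
  obtain b where b: "v = lc n r b (\<lambda>i. lc n m (T i) us)"
    using v unfolding Ur_vspan by (rule vspanE)
  have Tz: "Th *\<^sub>v lc n m (T i) us = ?z i" for i
    unfolding a_def[abs_def] using Th us by (rule mat_mult_lc)
  have Tv: "Th *\<^sub>v v = lc k r b ?z"
    using mat_mult_lc[OF Th, of r "\<lambda>i. lc n m (T i) us" b] by (simp add: b Tz)
  have "ip (?z i) (Th *\<^sub>v d c) = 0" if i: "i < r" for i
  proof -
    have il: "i < l" using i r by simp
    have "ip (?z i) (lc k r (\<lambda>i. conjugate (T i c)) ?z)
        = (\<Sum>j<r. conjugate (T j c) * (if i = j then of_real (lam i) else 0))"
      using il r by (subst E.lc_right) (auto simp: sketched_modes_orthogonal intro!: sum.cong)
    also have "\<dots> = conjugate (T i c) * of_real (lam i)"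
      using i by (simp add: if_distrib[of "\<lambda>x. _ * x"] cong: if_cong)
    finally show ?thesis
      using sketched_gram_eigenvector[OF il c] a_carrier[OF c] by (simp add: Th_d[OF c] defl_def E.minus_right mult.commute)
  qed
  moreover have Tdc: "Th *\<^sub>v d c \<in> carrier_vec k" using Th d_carrier[OF c] by simp
  ultimately have "ip (lc k r b ?z) (Th *\<^sub>v d c) = 0" by (simp add: E.lc_left)
  then show ?thesis using E.conj_sym[of "lc k r b ?z" "Th *\<^sub>v d c"] Tdc by (simp add: Tv)
qed

text \<open>\<open>projTheta\<close> is an arbitrary choice among minimizers, but only the minimal
  value enters, so it suffices to exhibit one minimizer.\<close>

lemma delta_pod_eq: "delta_pod Th m us Ur = (1 / real m) * (\<Sum>c<m. E.N (Th *\<^sub>v d c))"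
proof -
  have "(enorm (Th *\<^sub>v (us c - projTheta Th Ur (us c))))\<^sup>2 = E.N (Th *\<^sub>v d c)" if c: "c < m" for c
  proof -
    \<comment> \<open>Column \<open>c\<close> of \<open>U\<^sub>m T T\<^sup>H\<close>. It is a
      minimizer by Pythagoras, since the sketch of \<open>d c\<close> is orthogonal to the sketch of
      \<open>U\<^sub>r\<close>.\<close>
    define w where "w = lc n r (\<lambda>i. conjugate (T i c)) (\<lambda>i. lc n m (T i) us)"
    have wU: "w \<in> Ur" by (simp add: w_def Ur_vspan)
    have dw: "us c - w = d c" by (simp add: w_def d_eq)
    have Uc: "Ur \<subseteq> carrier_vec n" by (simp add: Ur_vspan vspan_carrier)
    have en: "(enorm x)\<^sup>2 = E.N x" for x by (simp add: enorm_def E.N_def)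
    have min: "E.N (Th *\<^sub>v d c) \<le> E.N (Th *\<^sub>v (us c - w'))" if w': "w' \<in> Ur" for w'
    proof -
      have vU: "w - w' \<in> Ur" using wU w' by (simp add: Ur_vspan vspan_diff)
      have w'c: "w' \<in> carrier_vec n" using w' Uc by auto
      have wc: "w \<in> carrier_vec n" using wU Uc by auto
      have "us c - w' = d c + (w - w')"
        unfolding dw[symmetric] using us[OF c] w'c wc by auto
      then have "Th *\<^sub>v (us c - w') = Th *\<^sub>v d c + Th *\<^sub>v (w - w')"
        using Th d_carrier[OF c] wc w'c by (simp add: mult_add_distrib_mat_vec[of _ k n])
      moreover have "E.N (Th *\<^sub>v d c + Th *\<^sub>v (w - w')) = E.N (Th *\<^sub>v d c) + E.N (Th *\<^sub>v (w - w'))"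
        using Th d_carrier[OF c] wc w'c Th_d_orthogonal_Ur[OF c vU]
        by (intro E.N_add_orthogonal) auto
      ultimately show ?thesis by simp
    qed
    have ex: "w \<in> Ur \<and> (\<forall>w'\<in>Ur. enorm (Th *\<^sub>v (us c - w)) \<le> enorm (Th *\<^sub>v (us c - w')))"
      using min wU by (auto simp: dw enorm_def E.N_def)
    let ?p = "projTheta Th Ur (us c)"
    have p: "?p \<in> Ur \<and> (\<forall>w'\<in>Ur. enorm (Th *\<^sub>v (us c - ?p)) \<le> enorm (Th *\<^sub>v (us c - w')))"
      unfolding projTheta_def by (rule someI, rule ex)
    then have "enorm (Th *\<^sub>v (us c - ?p)) = enorm (Th *\<^sub>v (us c - w))"
      using ex by (intro order_antisym) auto
    then show ?thesis by (simp add: dw en)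
  qed
  then show ?thesis by (simp add: delta_pod_def)
qed

section \<open>Comparing the true and the sketched errors\<close>

lemma projU_subspace:
  assumes "is_subspace n W" "x \<in> carrier_vec n"
  shows "projU R W x \<in> W" "v \<in> W \<Longrightarrow> ipU R v (x - projU R W x) = 0" "projU R W x \<in> carrier_vec n"
proof -
  obtain D w where w: "\<forall>i<D. w i \<in> carrier_vec n" and W: "W = vspan n D w"
    by (rule is_subspace_vspan_dim[OF assms(1)])
  show "projU R W x \<in> W" unfolding W by (rule projU_vspan(1)[OF R w[rule_format] assms(2)])
  then show "projU R W x \<in> carrier_vec n" using vspan_carrier unfolding W by blast
  show "v \<in> W \<Longrightarrow> ipU R v (x - projU R W x) = 0"
    unfolding W by (rule projU_vspan(2)[OF R w[rule_format] assms(2)])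
qed

text \<open>Best approximation: \<open>d c\<close> is a snapshot minus an element of
  \<open>U\<^sub>r\<close>, and the projection residual is the shortest such vector.\<close>

lemma pod_err_Ur_le: "pod_err R m us Ur \<le> (1 / real m) * (\<Sum>c<m. U.N (d c))"
proof -
  have "U.N (us c - projU R Ur (us c)) \<le> U.N (d c)" if c: "c < m" for c
  proof -
    let ?p = "projU R Ur (us c)" and ?w = "lc n r (\<lambda>i. conjugate (T i c)) (\<lambda>i. lc n m (T i) us)"
    have p: "?p \<in> Ur" and orth: "\<And>v. v \<in> Ur \<Longrightarrow> ipU R v (us c - ?p) = 0"
      using projU_vspan[OF R _ us[OF c], of r "\<lambda>i. lc n m (T i) us"] by (auto simp: Ur_vspan)
    have pc: "?p \<in> carrier_vec n" using p vspan_carrier unfolding Ur_vspan by blast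
    have "?p - ?w \<in> Ur" using p unfolding Ur_vspan by (intro vspan_diff) auto
    then have "U.N ((?p - ?w) + (us c - ?p)) = U.N (?p - ?w) + U.N (us c - ?p)"
      using pc us[OF c] orth by (intro U.N_add_orthogonal) auto
    moreover have "d c = (?p - ?w) + (us c - ?p)"
      using pc us[OF c] by (auto simp: d_eq)
    ultimately show ?thesis by simp
  qed
  then show ?thesis unfolding pod_err_eq by (intro mult_left_mono sum_mono) auto
qed

text \<open>Eckart-Young for the sketched snapshots, with the sketched projections to
  \<open>W\<close> as competitors. They lie in the image of \<open>W\<close>, which is spanned by
  \<open>r\<close> vectors.\<close>

lemma delta_pod_le:
  assumes W: "is_subspace n W" "sdim n W = r"
  shows "delta_pod Th m us Ur \<le> (1 / real m) * (\<Sum>c<m. E.N (Th *\<^sub>v (us c - projU R W (us c))))"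
proof -
  obtain D w where "D = sdim n W" and w': "\<forall>i<D. w i \<in> carrier_vec n" "W = vspan n D w"
    by (rule is_subspace_vspan_dim[OF W(1)])
  then have "D = r" using W(2) by simp
  then have w: "\<And>i. i < r \<Longrightarrow> w i \<in> carrier_vec n" "W = vspan n r w" using w' by simp_all
  \<comment> \<open>The sketch may collapse directions of \<open>W\<close>, so the orthonormal basis
    has length \<open>e \<le> r\<close> only.\<close>
  obtain e s where es: "e \<le> r" "E.orthonormal e s" "vspan k e s = vspan k r (\<lambda>i. Th *\<^sub>v w i)"
    using E.orthonormal_basis_exists[of r "\<lambda>i. Th *\<^sub>v w i"] w(1) Th by auto
  have A: "snap_mat k m a \<in> carrier_mat k m" unfolding snap_mat_def by (rule carrier_matI) simp_all
  have l: "l = vec_space.rank k (snap_mat k m a)"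
    using pairs by (simp add: sk_eigenpairs_def mult_snap_mat)
  obtain D' w' where "D' = vec_space.rank k (snap_mat k m a)"
    and w': "\<forall>i<D'. w' i \<in> carrier_vec k" "mrange (snap_mat k m a) = vspan k D' w'"
    by (rule mrange_vec_space_rank[OF A])
  then have "D' = l" using l by simp
  note w' = w'[unfolded this]
  let ?p = "\<lambda>c. projU R W (us c)"
  have "(\<Sum>c<m. E.N (defl k m r T a c)) \<le> (\<Sum>c<m. E.N (a c - Th *\<^sub>v ?p c))"
  proof (rule E.defl_optimal[OF a_carrier T_orth sketched_gram_eigenvector lam_pos _ w'(1)[rule_format] _ r es(1,2)])
    show "lam j \<le> lam i" if "i \<le> j" "j < l" for i j
      using pairs that by (auto simp: sk_eigenpairs_def)
    show "vspan k l w' = vspan k m a"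
      using w'(2) by (simp add: snap_mat_def mrange_mat_of_cols)
    fix c assume c: "c < m"
    have "?p c \<in> vspan n r w" using projU_subspace(1)[OF W(1) us[OF c]] w(2) by simp
    then obtain b where b: "?p c = lc n r b w" by (rule vspanE)
    have "Th *\<^sub>v ?p c = lc k r b (\<lambda>i. Th *\<^sub>v w i)"
      unfolding b using Th w(1) by (rule mat_mult_lc)
    then show "Th *\<^sub>v ?p c \<in> vspan k e s" by (simp add: es(3))
  qed auto
  also have "\<dots> = (\<Sum>c<m. E.N (Th *\<^sub>v (us c - ?p c)))"
    using Th us projU_subspace(3)[OF W(1)]
    by (intro sum.cong refl) (simp add: a_def mult_minus_distrib_mat_vec[of _ k n])
  finally show ?thesis
    unfolding delta_pod_eq by (intro mult_left_mono) (auto simp: Th_d)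
qed

text \<open>The upper embedding bound is assumed column by column, so that it can come either from
  the lines in part (i) or from the whole snapshot space in part (ii).\<close>

lemma delta_pod_le_pod_err:
  assumes W: "is_subspace n W" "sdim n W = r" and \<epsilon>: "0 \<le> \<epsilon>"
    and emb: "\<And>c. c < m \<Longrightarrow> E.N (Th *\<^sub>v (us c - projU R W (us c))) \<le> (1 + \<epsilon>) * U.N (us c - projU R W (us c))"
  shows "delta_pod Th m us Ur \<le> (1 + \<epsilon>) * pod_err R m us W"
proof -
  have "(\<Sum>c<m. E.N (Th *\<^sub>v (us c - projU R W (us c)))) \<le> (\<Sum>c<m. (1 + \<epsilon>) * U.N (us c - projU R W (us c)))"
    using emb by (intro sum_mono) auto
  then have "(1 / real m) * (\<Sum>c<m. E.N (Th *\<^sub>v (us c - projU R W (us c))))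
      \<le> (1 / real m) * (\<Sum>c<m. (1 + \<epsilon>) * U.N (us c - projU R W (us c)))"
    by (rule mult_left_mono) simp
  also have "\<dots> = (1 + \<epsilon>) * pod_err R m us W"
    by (simp add: pod_err_eq sum_distrib_left mult_ac)
  finally show ?thesis using delta_pod_le[OF W] by linarith
qed

lemma pod_err_le_delta_pod:
  assumes \<epsilon>: "0 \<le> \<epsilon>" "\<epsilon> < 1" and emb: "eps_embedding R Th \<epsilon> (mrange (snap_mat n m us))"
  shows "pod_err R m us Ur \<le> 1 / (1 - \<epsilon>) * delta_pod Th m us Ur"
proof -
  have "(\<Sum>c<m. U.N (d c)) \<le> (\<Sum>c<m. 1 / (1 - \<epsilon>) * E.N (Th *\<^sub>v d c))"
  proof (rule sum_mono)
    fix c assume "c \<in> {..<m}"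
    then have c: "c < m" by simp
    \<comment> \<open>Deflation only forms combinations of snapshots, so the lower embedding bound
      applies to \<open>d c\<close>.\<close>
    have "d c \<in> mrange (snap_mat n m us)"
      unfolding d_eq snap_mat_def mrange_mat_of_cols
      using us c by (intro vspan_diff vspan_mem vspan_lc) auto
    then have "(1 - \<epsilon>) * U.N (d c) \<le> E.N (Th *\<^sub>v d c)"
      using eps_embedding_bounds(1)[OF R Th emb _ d_carrier[OF c]] by (simp add: U.N_def E.N_def)
    then show "U.N (d c) \<le> 1 / (1 - \<epsilon>) * E.N (Th *\<^sub>v d c)" using \<epsilon> by (simp add: field_simps)
  qed
  then have "(1 / real m) * (\<Sum>c<m. U.N (d c)) \<le> (1 / real m) * (\<Sum>c<m. 1 / (1 - \<epsilon>) * E.N (Th *\<^sub>v d c))"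
    by (rule mult_left_mono) simp
  also have "\<dots> = 1 / (1 - \<epsilon>) * delta_pod Th m us Ur"
    by (simp add: delta_pod_eq sum_distrib_left mult_ac)
  finally show ?thesis using pod_err_Ur_le by linarith
qed

lemma pod_err_le_delta_pod_plus:
  assumes \<epsilon>: "0 \<le> \<epsilon>" "\<epsilon> < 1" and Y: "is_subspace n Y" "eps_embedding R Th \<epsilon> Y"
    and emb: "\<And>c. c < m \<Longrightarrow> eps_embedding R Th \<epsilon> (span1 (us c - projU R Y (us c)))"
  shows "pod_err R m us Ur \<le> 2 / (1 - \<epsilon>) * delta_pod Th m us Ur
           + (2 * (1 + \<epsilon>) / (1 - \<epsilon>) + 1) * pod_err R m us Y"
proof -
  obtain D w where w: "\<forall>i<D. w i \<in> carrier_vec n" "Y = vspan n D w"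
    by (rule is_subspace_vspan_dim[OF Y(1)])
  define p where "p c = projU R Y (us c)" for c
  define f where "f c = us c - p c" for c
  have pY: "p c \<in> Y" and pc: "p c \<in> carrier_vec n" and fc: "f c \<in> carrier_vec n"
    and forth: "\<And>v. v \<in> Y \<Longrightarrow> ipU R v (f c) = 0" if "c < m" for c
    using projU_subspace[OF Y(1) us[OF that]] us[OF that] by (auto simp: p_def f_def)
  have Yc: "Y \<subseteq> carrier_vec n" using w(2) vspan_carrier by blast
  let ?P = "defl n m r T p" and ?F = "defl n m r T f"
  have upf: "us c = p c + f c" if "c < m" for c
    unfolding f_def using us[OF that] pc[OF that] by auto
  have dPF: "d c = ?P c + ?F c" if "c < m" for c
    unfolding d_def using pc fc upf that by (rule defl_add)
  \<comment> \<open>Deflation combines columns linearly, so \<open>?P\<close> stays in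
    \<open>Y\<close>; for the same reason \<open>?F\<close> stays orthogonal to \<open>Y\<close>
    below.\<close>
  have PY: "?P c \<in> Y" if "c < m" for c
  proof -
    have "?P c \<in> vspan n D w"
      unfolding defl_def using pY that w(2) by (intro vspan_diff vspan_lc) auto
    then show ?thesis using w(2) by simp
  qed
  have FY: "ipU R v (?F c) = 0" if "v \<in> Y" "c < m" for v c
  proof -
    have v: "v \<in> carrier_vec n" using that(1) Yc by auto
    have "ipU R v (lc n m (T i) f) = 0" for i
      using v fc forth that(1) by (simp add: U.lc_right)
    then have "ipU R v (lc n r (\<lambda>i. conjugate (T i c)) (\<lambda>i. lc n m (T i) f)) = 0"
      using v by (simp add: U.lc_right)
    then show ?thesis using v fc[OF that(2)] forth[OF that(2,1)] by (simp add: defl_def U.minus_right)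
  qed
  have Torth: "coeff_orth m r T" using T_orth r(2) by (rule coeff_orth_mono)
  have ThF: "Th *\<^sub>v ?F c = defl k m r T (\<lambda>c. Th *\<^sub>v f c) c" if "c < m" for c
    using Th fc that by (rule mat_mult_defl)
  \<comment> \<open>Pythagoras splits \<open>d c\<close>; the lower embedding bound on
    \<open>Y\<close> contributes \<open>1 / (1 - \<epsilon>)\<close> and the parallelogram
    inequality the factor 2.\<close>
  have step: "U.N (d c) \<le> 2 / (1 - \<epsilon>) * E.N (Th *\<^sub>v d c) + 2 / (1 - \<epsilon>) * E.N (Th *\<^sub>v ?F c) + U.N (?F c)"
    if c: "c < m" for c
  proof -
    have Pc: "?P c \<in> carrier_vec n" and Fc: "?F c \<in> carrier_vec n" using pc[OF c] fc[OF c] by auto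
    have "U.N (d c) = U.N (?P c) + U.N (?F c)"
      unfolding dPF[OF c] by (rule U.N_add_orthogonal[OF Pc Fc FY[OF PY[OF c] c]])
    moreover have "(1 - \<epsilon>) * U.N (?P c) \<le> E.N (Th *\<^sub>v ?P c)"
      using eps_embedding_bounds(1)[OF R Th Y(2) PY[OF c] Pc] by (simp add: U.N_def E.N_def)
    moreover have "E.N (Th *\<^sub>v ?P c) \<le> 2 * E.N (Th *\<^sub>v d c) + 2 * E.N (Th *\<^sub>v ?F c)"
    proof -
      have "?P c = d c - ?F c" unfolding dPF[OF c] using Pc Fc by auto
      then have "Th *\<^sub>v ?P c = Th *\<^sub>v d c - Th *\<^sub>v ?F c"
        using Th d_carrier[OF c] Fc by (simp add: mult_minus_distrib_mat_vec[of _ k n])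
      then show ?thesis using E.parallelogram_le[of "Th *\<^sub>v d c" "Th *\<^sub>v ?F c"] Th d_carrier[OF c] Fc
        by simp
    qed
    ultimately have "(1 - \<epsilon>) * (U.N (d c) - U.N (?F c)) \<le> 2 * E.N (Th *\<^sub>v d c) + 2 * E.N (Th *\<^sub>v ?F c)"
      by simp
    then have "U.N (d c) - U.N (?F c) \<le> (2 * E.N (Th *\<^sub>v d c) + 2 * E.N (Th *\<^sub>v ?F c)) / (1 - \<epsilon>)"
      using \<epsilon> by (simp add: pos_le_divide_eq mult.commute)
    then show ?thesis by (simp add: add_divide_distrib)
  qed
  have UF: "(\<Sum>c<m. U.N (?F c)) \<le> (\<Sum>c<m. U.N (f c))"
    using U.sum_N_defl[OF fc Torth] sum_nonneg[of "{..<r}" "\<lambda>i. U.N (lc n m (T i) f)"] by simp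
  \<comment> \<open>The embedding is assumed on the line through each \<open>f c\<close>, not on
    that of \<open>?F c\<close>. Deflation is therefore moved past \<open>Th\<close> and discarded
    by contraction before the embedding is applied.\<close>
  have "(\<Sum>c<m. E.N (Th *\<^sub>v ?F c)) = (\<Sum>c<m. E.N (defl k m r T (\<lambda>c. Th *\<^sub>v f c) c))"
    by (simp add: ThF)
  also have "\<dots> \<le> (\<Sum>c<m. E.N (Th *\<^sub>v f c))"
    using E.sum_N_defl[of m "\<lambda>c. Th *\<^sub>v f c" r T] Torth fc Th
      sum_nonneg[of "{..<r}" "\<lambda>i. E.N (lc k m (T i) (\<lambda>c. Th *\<^sub>v f c))"] by simp
  also have "\<dots> \<le> (\<Sum>c<m. (1 + \<epsilon>) * U.N (f c))"
  proof (rule sum_mono)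
    fix c assume "c \<in> {..<m}"
    then have c: "c < m" by simp
    have "f c \<in> span1 (f c)" unfolding span1_def by (rule CollectI, rule exI[of _ 1]) simp
    then show "E.N (Th *\<^sub>v f c) \<le> (1 + \<epsilon>) * U.N (f c)"
      using eps_embedding_bounds(2)[OF R Th emb[OF c] _ fc[OF c]]
      by (simp add: U.N_def E.N_def f_def p_def)
  qed
  finally have EF: "(\<Sum>c<m. E.N (Th *\<^sub>v ?F c)) \<le> (1 + \<epsilon>) * (\<Sum>c<m. U.N (f c))"
    by (simp add: sum_distrib_left)
  have "(\<Sum>c<m. U.N (d c)) \<le> (\<Sum>c<m. 2 / (1 - \<epsilon>) * E.N (Th *\<^sub>v d c) + 2 / (1 - \<epsilon>) * E.N (Th *\<^sub>v ?F c) + U.N (?F c))"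
    using step by (intro sum_mono) auto
  also have "\<dots> = 2 / (1 - \<epsilon>) * (\<Sum>c<m. E.N (Th *\<^sub>v d c))
      + 2 / (1 - \<epsilon>) * (\<Sum>c<m. E.N (Th *\<^sub>v ?F c)) + (\<Sum>c<m. U.N (?F c))"
    by (simp add: sum.distrib sum_distrib_left)
  also have "\<dots> \<le> 2 / (1 - \<epsilon>) * (\<Sum>c<m. E.N (Th *\<^sub>v d c))
      + 2 / (1 - \<epsilon>) * ((1 + \<epsilon>) * (\<Sum>c<m. U.N (f c))) + (\<Sum>c<m. U.N (f c))"
    using EF UF \<epsilon> by (intro add_mono mult_left_mono order_refl) auto
  \<comment> \<open>The sketched part of \<open>?F\<close> contributes
    \<open>2 * (1 + \<epsilon>) / (1 - \<epsilon>)\<close> and its true norm the extra 1 in front of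
    the error of \<open>Y\<close>.\<close>
  finally have "(1 / real m) * (\<Sum>c<m. U.N (d c)) \<le> (1 / real m) * (2 / (1 - \<epsilon>) * (\<Sum>c<m. E.N (Th *\<^sub>v d c))
      + 2 / (1 - \<epsilon>) * ((1 + \<epsilon>) * (\<Sum>c<m. U.N (f c))) + (\<Sum>c<m. U.N (f c)))"
    by (rule mult_left_mono) simp
  also have "\<dots> = 2 / (1 - \<epsilon>) * delta_pod Th m us Ur
           + (2 * (1 + \<epsilon>) / (1 - \<epsilon>) + 1) * pod_err R m us Y"
    unfolding delta_pod_eq pod_err_eq p_def[symmetric] f_def[symmetric]
    by (simp add: algebra_simps add_divide_distrib)
  finally show ?thesis using pod_err_Ur_le by linarith
qed

end

section \<open>Both chains of inequalities over a generic scalar field\<close>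

lemma sketched_pod_quasi_optimal:
  fixes R Th :: "'a::rc_field mat" and us t :: "nat \<Rightarrow> 'a vec"
  assumes R: "hermitian_pd n R" and us: "\<forall>i<m. us i \<in> carrier_vec n" and Th: "Th \<in> carrier_mat k n"
    and \<epsilon>: "0 \<le> \<epsilon>" "\<epsilon> < 1" and Ustar: "POD_minimizer n R m us r Ustar"
    and pairs: "sk_eigenpairs n k m Th us l lam t" and r: "0 < r" "r \<le> l"
  shows "\<lbrakk>is_subspace n Y; eps_embedding R Th \<epsilon> Y;
        \<forall>i<m. eps_embedding R Th \<epsilon> (span1 (us i - projU R Y (us i)));
        \<forall>i<m. eps_embedding R Th \<epsilon> (span1 (us i - projU R Ustar (us i)))\<rbrakk> \<Longrightarrow>
        pod_err R m us (sk_Ur n m us t r)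
          \<le> 2 / (1 - \<epsilon>) * delta_pod Th m us (sk_Ur n m us t r)
             + (2 * (1 + \<epsilon>) / (1 - \<epsilon>) + 1) * pod_err R m us Y \<and>
        2 / (1 - \<epsilon>) * delta_pod Th m us (sk_Ur n m us t r)
             + (2 * (1 + \<epsilon>) / (1 - \<epsilon>) + 1) * pod_err R m us Y
          \<le> 2 * (1 + \<epsilon>) / (1 - \<epsilon>) * pod_err R m us Ustar
             + (2 * (1 + \<epsilon>) / (1 - \<epsilon>) + 1) * pod_err R m us Y"
    and "eps_embedding R Th \<epsilon> (mrange (snap_mat n m us)) \<Longrightarrow>
        pod_err R m us (sk_Ur n m us t r) \<le> 1 / (1 - \<epsilon>) * delta_pod Th m us (sk_Ur n m us t r) \<and>
        1 / (1 - \<epsilon>) * delta_pod Th m us (sk_Ur n m us t r) \<le> (1 + \<epsilon>) / (1 - \<epsilon>) * pod_err R m us Ustar"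
proof -
  interpret sketched_snapshots n k m r l R Th us t lam
    using assms by unfold_locales auto
  have W: "is_subspace n Ustar" "sdim n Ustar = r" "Ustar \<subseteq> mrange (snap_mat n m us)"
    using Ustar by (auto simp: POD_minimizer_def)
  let ?g = "\<lambda>c. us c - projU R Ustar (us c)"
  have gc: "?g c \<in> carrier_vec n" if "c < m" for c
    using projU_subspace(3)[OF W(1)] us that by auto
  {
    assume Y: "is_subspace n Y" "eps_embedding R Th \<epsilon> Y"
        "\<forall>i<m. eps_embedding R Th \<epsilon> (span1 (us i - projU R Y (us i)))"
      and emb: "\<forall>i<m. eps_embedding R Th \<epsilon> (span1 (?g i))"
    have "delta_pod Th m us Ur \<le> (1 + \<epsilon>) * pod_err R m us Ustar"
    proof (rule delta_pod_le_pod_err[OF W(1,2) \<epsilon>(1)])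
      fix c assume c: "c < m"
      have "?g c \<in> span1 (?g c)" unfolding span1_def by (rule CollectI, rule exI[of _ 1]) simp
      then show "E.N (Th *\<^sub>v ?g c) \<le> (1 + \<epsilon>) * U.N (?g c)"
        using eps_embedding_bounds(2)[OF R Th emb[rule_format, OF c] _ gc[OF c]]
        by (simp add: U.N_def E.N_def)
    qed
    then have "2 / (1 - \<epsilon>) * delta_pod Th m us Ur \<le> 2 / (1 - \<epsilon>) * ((1 + \<epsilon>) * pod_err R m us Ustar)"
      using \<epsilon> by (intro mult_left_mono) auto
    then have "2 / (1 - \<epsilon>) * delta_pod Th m us Ur \<le> 2 * (1 + \<epsilon>) / (1 - \<epsilon>) * pod_err R m us Ustar"
      by (simp only: times_divide_eq_left times_divide_eq_right mult.assoc)
    then show "pod_err R m us Ur \<le> 2 / (1 - \<epsilon>) * delta_pod Th m us Ur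
             + (2 * (1 + \<epsilon>) / (1 - \<epsilon>) + 1) * pod_err R m us Y \<and>
        2 / (1 - \<epsilon>) * delta_pod Th m us Ur + (2 * (1 + \<epsilon>) / (1 - \<epsilon>) + 1) * pod_err R m us Y
          \<le> 2 * (1 + \<epsilon>) / (1 - \<epsilon>) * pod_err R m us Ustar
             + (2 * (1 + \<epsilon>) / (1 - \<epsilon>) + 1) * pod_err R m us Y"
      using pod_err_le_delta_pod_plus[OF \<epsilon> Y(1,2)] Y(3) by simp
  next
    assume emb: "eps_embedding R Th \<epsilon> (mrange (snap_mat n m us))"
    have "delta_pod Th m us Ur \<le> (1 + \<epsilon>) * pod_err R m us Ustar"
    proof (rule delta_pod_le_pod_err[OF W(1,2) \<epsilon>(1)])
      fix c assume c: "c < m"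
      have "projU R Ustar (us c) \<in> vspan n m us"
        using projU_subspace(1)[OF W(1)] us c W(3) by (auto simp: snap_mat_def mrange_mat_of_cols)
      then have "?g c \<in> mrange (snap_mat n m us)"
        unfolding snap_mat_def mrange_mat_of_cols using us c by (intro vspan_diff vspan_mem) auto
      then show "E.N (Th *\<^sub>v ?g c) \<le> (1 + \<epsilon>) * U.N (?g c)"
        using eps_embedding_bounds(2)[OF R Th emb _ gc[OF c]] by (simp add: U.N_def E.N_def)
    qed
    then have "1 / (1 - \<epsilon>) * delta_pod Th m us Ur \<le> 1 / (1 - \<epsilon>) * ((1 + \<epsilon>) * pod_err R m us Ustar)"
      using \<epsilon> by (intro mult_left_mono) auto
    then show "pod_err R m us Ur \<le> 1 / (1 - \<epsilon>) * delta_pod Th m us Ur \<and>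
        1 / (1 - \<epsilon>) * delta_pod Th m us Ur \<le> (1 + \<epsilon>) / (1 - \<epsilon>) * pod_err R m us Ustar"
      using pod_err_le_delta_pod[OF \<epsilon> emb] by simp
  }
qed

theorem theorem5p4:
  shows "(\<forall>(n::nat) (k::nat) (m::nat) (r::nat) (R::real mat) (us::nat \<Rightarrow> real vec) (Th::real mat)
      (\<epsilon>::real) (Ustar::real vec set) (l::nat) (lam::nat \<Rightarrow> real) (t::nat \<Rightarrow> real vec).
     hermitian_pd n R \<and> 0 < m \<and> (\<forall>i<m. us i \<in> carrier_vec n) \<and> Th \<in> carrier_mat k n \<and>
     0 \<le> \<epsilon> \<and> \<epsilon> < 1 \<and> 0 < r \<and>
     POD_minimizer n R m us r Ustar \<and>
     sk_eigenpairs n k m Th us l lam t \<and> r \<le> l \<longrightarrow>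
     (\<forall>Y. is_subspace n Y \<and> Y \<subseteq> mrange (snap_mat n m us) \<and> r \<le> sdim n Y \<and>
          eps_embedding R Th \<epsilon> Y \<and>
          (\<forall>i<m. eps_embedding R Th \<epsilon> (span1 (us i - projU R Y (us i)))) \<and>
          (\<forall>i<m. eps_embedding R Th \<epsilon> (span1 (us i - projU R Ustar (us i)))) \<longrightarrow>
        pod_err R m us (sk_Ur n m us t r)
          \<le> 2 / (1 - \<epsilon>) * delta_pod Th m us (sk_Ur n m us t r)
             + (2 * (1 + \<epsilon>) / (1 - \<epsilon>) + 1) * pod_err R m us Y \<and>
        2 / (1 - \<epsilon>) * delta_pod Th m us (sk_Ur n m us t r)
             + (2 * (1 + \<epsilon>) / (1 - \<epsilon>) + 1) * pod_err R m us Y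
          \<le> 2 * (1 + \<epsilon>) / (1 - \<epsilon>) * pod_err R m us Ustar
             + (2 * (1 + \<epsilon>) / (1 - \<epsilon>) + 1) * pod_err R m us Y) \<and>
     (eps_embedding R Th \<epsilon> (mrange (snap_mat n m us)) \<and> r \<le> sdim n (mrange (snap_mat n m us)) \<longrightarrow>
        pod_err R m us (sk_Ur n m us t r) \<le> 1 / (1 - \<epsilon>) * delta_pod Th m us (sk_Ur n m us t r) \<and>
        1 / (1 - \<epsilon>) * delta_pod Th m us (sk_Ur n m us t r) \<le> (1 + \<epsilon>) / (1 - \<epsilon>) * pod_err R m us Ustar))
   \<and>
   (\<forall>(n::nat) (k::nat) (m::nat) (r::nat) (R::complex mat) (us::nat \<Rightarrow> complex vec) (Th::complex mat)
      (\<epsilon>::real) (Ustar::complex vec set) (l::nat) (lam::nat \<Rightarrow> real) (t::nat \<Rightarrow> complex vec).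
     hermitian_pd n R \<and> 0 < m \<and> (\<forall>i<m. us i \<in> carrier_vec n) \<and> Th \<in> carrier_mat k n \<and>
     0 \<le> \<epsilon> \<and> \<epsilon> < 1 \<and> 0 < r \<and>
     POD_minimizer n R m us r Ustar \<and>
     sk_eigenpairs n k m Th us l lam t \<and> r \<le> l \<longrightarrow>
     (\<forall>Y. is_subspace n Y \<and> Y \<subseteq> mrange (snap_mat n m us) \<and> r \<le> sdim n Y \<and>
          eps_embedding R Th \<epsilon> Y \<and>
          (\<forall>i<m. eps_embedding R Th \<epsilon> (span1 (us i - projU R Y (us i)))) \<and>
          (\<forall>i<m. eps_embedding R Th \<epsilon> (span1 (us i - projU R Ustar (us i)))) \<longrightarrow>
        pod_err R m us (sk_Ur n m us t r)
          \<le> 2 / (1 - \<epsilon>) * delta_pod Th m us (sk_Ur n m us t r)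
             + (2 * (1 + \<epsilon>) / (1 - \<epsilon>) + 1) * pod_err R m us Y \<and>
        2 / (1 - \<epsilon>) * delta_pod Th m us (sk_Ur n m us t r)
             + (2 * (1 + \<epsilon>) / (1 - \<epsilon>) + 1) * pod_err R m us Y
          \<le> 2 * (1 + \<epsilon>) / (1 - \<epsilon>) * pod_err R m us Ustar
             + (2 * (1 + \<epsilon>) / (1 - \<epsilon>) + 1) * pod_err R m us Y) \<and>
     (eps_embedding R Th \<epsilon> (mrange (snap_mat n m us)) \<and> r \<le> sdim n (mrange (snap_mat n m us)) \<longrightarrow>
        pod_err R m us (sk_Ur n m us t r) \<le> 1 / (1 - \<epsilon>) * delta_pod Th m us (sk_Ur n m us t r) \<and>
        1 / (1 - \<epsilon>) * delta_pod Th m us (sk_Ur n m us t r) \<le> (1 + \<epsilon>) / (1 - \<epsilon>) * pod_err R m us Ustar))"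
  \<comment> \<open>The two conjuncts are the real and complex instances of the generic result, each
    split into parts (i) and (ii).\<close>
  apply (rule conjI; intro allI impI; elim conjE; rule conjI; intro allI impI; elim conjE)
  by (rule sketched_pod_quasi_optimal, assumption+)+

end
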